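(* Let $D$ be a bounded domain in $\mathbb{C}^n$, $n\geq 2$, and assume $D$ is pseudoconvex. (a) Suppose $D$ is contractible. If there exist a point $z\in D$ and $m\in\mathbb{N}$, $2\leq m\leq n$, such that $s_D(z)>1/\sqrt{m}$, then $D$ is not biholomorphic to a Cartesian product of $m$ or more irreducible factors. (b) Suppose $n\geq 4$. If there exist a point $z\in D$ and $m\in\mathbb{N}$, $2\leq m\leq n/2$, such that $s_D(z)>1/\sqrt{m}$, then $D$ is not biholomorphic to a Cartesian product of $m$ factors, each of complex dimension $\geq 2$ (the factors here are not required to be irreducible).
   Context: Squeezing function: write $B^n(0,r)$ for the open Euclidean ball of radius $r$ centred at $0$ in $\mathbb{C}^n$. For a bounded domain $D\subset\mathbb{C}^n$ and $z\in D$, $s_D(z):=\sup\{s_D(z;F) : F:D\to B^n(0,1)$ is an injective holomorphic map with $F(z)=0\}$, where $s_D(z;F):=\sup\{r>0 : B^n(0,r)\subset F(D)\}$. Factors of a product are domains in complex Euclidean spaces of positive dimension. A domain in $\mathbb{C}^k$, $k\geq 2$, is irreducible if it is not biholomorphic to a Cartesian product of domains of lower dimension; a planar domain (a domain in $\mathbb{C}$) is allowed as an irreducible factor. *)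

theory Defs
  imports "HOL-Analysis.Analysis"
begin

text \<open>
  The dimension of a complex Euclidean space varies inside the statements below (the factors of a
  product have arbitrary dimensions), so \<^term>\<open>Cn n\<close> is modelled, like \<open>Euclidean_space n\<close> over the
  reals, by the functions \<^typ>\<open>nat \<Rightarrow> complex\<close> vanishing from index \<open>n\<close> on. The product topology
  of \<^typ>\<open>nat \<Rightarrow> complex\<close> induces the Euclidean topology on it, so the library notions of
  open, connected, compact and contractible sets and of continuity and limits apply directly.
  The library metric on \<^typ>\<open>nat \<Rightarrow> complex\<close>, however, is not the Euclidean one; norms, balls and
  boundedness are therefore expressed with \<open>cnorm\<close>.
\<close>

definition Cn :: "nat \<Rightarrow> (nat \<Rightarrow> complex) set" where
  "Cn n = {z. \<forall>i\<ge>n. z i = 0}"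

definition cnorm :: "nat \<Rightarrow> (nat \<Rightarrow> complex) \<Rightarrow> real" where
  "cnorm n z = L2_set (\<lambda>i. cmod (z i)) {..<n}"

definition Bn :: "nat \<Rightarrow> real \<Rightarrow> (nat \<Rightarrow> complex) set" where
  "Bn n r = {z \<in> Cn n. cnorm n z < r}"

definition cdomain :: "nat \<Rightarrow> (nat \<Rightarrow> complex) set \<Rightarrow> bool" where
  "cdomain n D \<longleftrightarrow> openin (top_of_set (Cn n)) D \<and> connected D \<and> D \<noteq> {}"

definition cbounded :: "nat \<Rightarrow> (nat \<Rightarrow> complex) set \<Rightarrow> bool" where
  "cbounded n D \<longleftrightarrow> (\<exists>M. \<forall>z\<in>D. cnorm n z \<le> M)"


text \<open>
  Holomorphic maps from an open subset \<open>D\<close> of \<^term>\<open>Cn n\<close> to \<^term>\<open>Cn k\<close>: every component has a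
  complex-linear Frechet derivative at each point of \<open>D\<close>.
\<close>

definition complex_differentiable_at ::
    "nat \<Rightarrow> (nat \<Rightarrow> complex) set \<Rightarrow> ((nat \<Rightarrow> complex) \<Rightarrow> complex) \<Rightarrow> (nat \<Rightarrow> complex) \<Rightarrow> bool" where
  "complex_differentiable_at n D g z \<longleftrightarrow>
     (\<exists>a :: nat \<Rightarrow> complex.
        ((\<lambda>w. cmod (g w - g z - (\<Sum>i<n. a i * (w i - z i))) / cnorm n (\<lambda>i. w i - z i))
           \<longlongrightarrow> 0) (at z within D))"

definition holomorphic_map ::
    "nat \<Rightarrow> nat \<Rightarrow> (nat \<Rightarrow> complex) set \<Rightarrow> ((nat \<Rightarrow> complex) \<Rightarrow> (nat \<Rightarrow> complex)) \<Rightarrow> bool" where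
  "holomorphic_map n k D f \<longleftrightarrow>
     f ` D \<subseteq> Cn k \<and> (\<forall>z\<in>D. \<forall>j<k. complex_differentiable_at n D (\<lambda>w. f w j) z)"

definition biholomorphic ::
    "nat \<Rightarrow> (nat \<Rightarrow> complex) set \<Rightarrow> nat \<Rightarrow> (nat \<Rightarrow> complex) set \<Rightarrow> bool" where
  "biholomorphic n D k E \<longleftrightarrow>
     (\<exists>f g. holomorphic_map n k D f \<and> holomorphic_map k n E g \<and> f ` D = E \<and> g ` E = D \<and>
            (\<forall>z\<in>D. g (f z) = z) \<and> (\<forall>w\<in>E. f (g w) = w))"


text \<open>
  The Cartesian product of \<open>E 0, \<dots>, E (l - 1)\<close>, where \<open>E j\<close> is contained in \<open>Cn (k j)\<close>, as a subset
  of \<open>Cn (\<Sum>j<l. k j)\<close>: the coordinates of the factors are concatenated, so that \<open>E j\<close> uses the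
  \<open>k j\<close> coordinates starting at \<open>\<Sum>i<j. k i\<close>.
\<close>

definition coord_block :: "(nat \<Rightarrow> nat) \<Rightarrow> nat \<Rightarrow> (nat \<Rightarrow> complex) \<Rightarrow> (nat \<Rightarrow> complex)" where
  "coord_block k j z = (\<lambda>i. if i < k j then z ((\<Sum>t<j. k t) + i) else 0)"

definition cart_prod ::
    "nat \<Rightarrow> (nat \<Rightarrow> nat) \<Rightarrow> (nat \<Rightarrow> (nat \<Rightarrow> complex) set) \<Rightarrow> (nat \<Rightarrow> complex) set" where
  "cart_prod l k E = {z \<in> Cn (\<Sum>j<l. k j). \<forall>j<l. coord_block k j z \<in> E j}"

definition irreducible_domain :: "nat \<Rightarrow> (nat \<Rightarrow> complex) set \<Rightarrow> bool" where
  "irreducible_domain d D \<longleftrightarrow>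
     cdomain d D \<and>
     (d = 1 \<or>
      d \<ge> 2 \<and>
      \<not> (\<exists>l k E. l \<ge> 2 \<and> (\<forall>j<l. 1 \<le> k j \<and> k j < d \<and> cdomain (k j) (E j)) \<and>
                 biholomorphic d D (\<Sum>j<l. k j) (cart_prod l k E)))"


text \<open>
  For continuous real-valued functions plurisubharmonicity is the sub-mean-value inequality
  on all closed affine complex discs contained in \<open>D\<close>. Pseudoconvexity is the existence of a
  continuous plurisubharmonic exhaustion function.
\<close>

definition continuous_psh ::
    "nat \<Rightarrow> (nat \<Rightarrow> complex) set \<Rightarrow> ((nat \<Rightarrow> complex) \<Rightarrow> real) \<Rightarrow> bool" where
  "continuous_psh n D u \<longleftrightarrow>
     continuous_on D u \<and>
     (\<forall>a\<in>D. \<forall>b\<in>Cn n.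
        (\<forall>\<zeta>. cmod \<zeta> \<le> 1 \<longrightarrow> (\<lambda>i. a i + \<zeta> * b i) \<in> D) \<longrightarrow>
        u a \<le> 1 / (2 * pi) * integral {0..2 * pi} (\<lambda>t. u (\<lambda>i. a i + cis t * b i)))"

definition pseudoconvex :: "nat \<Rightarrow> (nat \<Rightarrow> complex) set \<Rightarrow> bool" where
  "pseudoconvex n D \<longleftrightarrow>
     (\<exists>u. continuous_psh n D u \<and> (\<forall>c. compact {z \<in> D. u z \<le> c}))"


text \<open>
  Suprema are taken in the complete lattice \<^typ>\<open>ereal\<close>. For a bounded domain \<open>D\<close> of positive
  dimension and \<open>z\<close> in \<open>D\<close> both sets are nonempty and bounded by 1, so the values are the usual
  real ones.
\<close>

definition squeezing_radius ::
    "nat \<Rightarrow> (nat \<Rightarrow> complex) set \<Rightarrow> ((nat \<Rightarrow> complex) \<Rightarrow> (nat \<Rightarrow> complex)) \<Rightarrow> ereal" where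
  "squeezing_radius n D F = Sup {ereal r | r. r > 0 \<and> Bn n r \<subseteq> F ` D}"

definition squeezing_function :: "nat \<Rightarrow> (nat \<Rightarrow> complex) set \<Rightarrow> (nat \<Rightarrow> complex) \<Rightarrow> ereal" where
  "squeezing_function n D z =
     Sup {squeezing_radius n D F | F.
            holomorphic_map n n D F \<and> F ` D \<subseteq> Bn n 1 \<and> inj_on F D \<and> F z = (\<lambda>i. 0)}"

end

theory Submission
  imports Defs "HOL-Complex_Analysis.Conformal_Mappings" "HOL-Homology.Invariance_of_Domain"
begin

text \<open>
  Suppose \<open>D\<close> is biholomorphic to a product of \<open>l\<close> factors and \<open>F\<close> embeds \<open>D\<close> into the unit ball,
  with \<open>Bn n r\<close> in the image. Let \<open>p\<close> be the point of the product that goes to the origin, and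
  move only the first coordinate of each factor away from \<open>p\<close>. This gives a separately holomorphic
  map \<open>\<phi>\<close> of \<open>l\<close> complex variables with \<open>\<phi> 0 = 0\<close> and \<open>norm \<phi> \<le> 1\<close>. For \<open>s < r\<close> the part of the
  \<open>j\<close>-th coordinate axis where \<open>norm \<phi> \<le> s\<close> is compact, since \<open>F\<close> has a continuous inverse by
  invariance of domain. By the maximum principle no holomorphic function has a real part that is
  larger on the whole level set \<open>norm \<phi> = s\<close> of this axis than at \<open>0\<close>, so the level set carries
  finite averages that approximate evaluation at \<open>0\<close>, uniformly on compact families of holomorphic
  functions. With respect to the product of these averages the restrictions of \<open>\<phi>\<close> to the axes are
  almost orthogonal projections of \<open>\<phi>\<close>, and Bessel's inequality yields \<open>l * s\<^sup>2 \<le> 1\<close>.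
\<close>

subsection \<open>Averages over finite lists\<close>

text \<open>A list serves as a finitely supported probability measure with multiplicities. The empty
  list yields 0, hence the nonemptiness hypotheses where constants must be preserved.\<close>

definition avg :: "'a list \<Rightarrow> ('a \<Rightarrow> 'b::real_normed_vector) \<Rightarrow> 'b" where
  "avg xs f = (\<Sum>x\<leftarrow>xs. f x) /\<^sub>R real (length xs)"

lemma avg_cong: "(\<And>x. x \<in> set xs \<Longrightarrow> f x = g x) \<Longrightarrow> avg xs f = avg xs g"
  by (simp add: avg_def cong: map_cong)

lemma avg_add: "avg xs (\<lambda>x. f x + g x) = avg xs f + avg xs g"
  by (simp add: avg_def sum_list_addf scaleR_add_right)

lemma avg_linear:
  assumes "linear h"
  shows "avg xs (\<lambda>x. h (f x)) = h (avg xs f)"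
proof -
  have "(\<Sum>x\<leftarrow>xs. h (f x)) = h (\<Sum>x\<leftarrow>xs. f x)"
    by (induction xs) (auto simp: linear_0[OF assms] linear_add[OF assms])
  then show ?thesis by (simp add: avg_def linear_cmul[OF assms])
qed

lemma avg_uminus: "avg xs (\<lambda>x. - f x) = - avg xs f"
  by (rule avg_linear) (simp add: linear_iff)

lemma avg_diff: "avg xs (\<lambda>x. f x - g x) = avg xs f - avg xs g"
  using avg_add[of xs f "\<lambda>x. - g x"] by (simp add: avg_uminus)

lemma avg_const:
  assumes "xs \<noteq> []"
  shows "avg xs (\<lambda>x. c) = c"
proof -
  have "(\<Sum>x\<leftarrow>xs. c) = real (length xs) *\<^sub>R c"
    by (induction xs) (auto simp: algebra_simps)
  with assms show ?thesis by (simp add: avg_def)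
qed

lemma avg_sum: "avg xs (\<lambda>x. \<Sum>k\<in>A. f k x) = (\<Sum>k\<in>A. avg xs (f k))"
proof -
  have "(\<Sum>x\<leftarrow>xs. \<Sum>k\<in>A. f k x) = (\<Sum>k\<in>A. \<Sum>x\<leftarrow>xs. f k x)"
    by (induction xs) (auto simp: sum.distrib)
  then show ?thesis by (simp add: avg_def scaleR_sum_right)
qed

lemma avg_mono:
  fixes f g :: "'a \<Rightarrow> real"
  assumes "\<And>x. x \<in> set xs \<Longrightarrow> f x \<le> g x"
  shows "avg xs f \<le> avg xs g"
  unfolding avg_def using assms
  by (auto intro!: mult_left_mono sum_list_mono)

lemma norm_avg_le: "norm (avg xs f) \<le> avg xs (\<lambda>x. norm (f x))"
proof -
  have "norm (\<Sum>x\<leftarrow>xs. f x) \<le> (\<Sum>x\<leftarrow>xs. norm (f x))"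
    by (induction xs) (auto intro: norm_triangle_le)
  then show ?thesis by (simp add: avg_def mult_left_mono)
qed

lemma norm_avg_bound:
  assumes "xs \<noteq> []" "\<And>x. x \<in> set xs \<Longrightarrow> norm (f x) \<le> B"
  shows "norm (avg xs f) \<le> B"
proof -
  have "norm (avg xs f) \<le> avg xs (\<lambda>x. norm (f x))" by (rule norm_avg_le)
  also have "\<dots> \<le> avg xs (\<lambda>x. B)" using assms(2) by (rule avg_mono)
  finally show ?thesis using assms(1) by (simp add: avg_const)
qed

lemma sum_list_scaleR:
  fixes f :: "'a \<Rightarrow> 'b::real_vector"
  shows "(\<Sum>x\<leftarrow>xs. r *\<^sub>R f x) = r *\<^sub>R (\<Sum>x\<leftarrow>xs. f x)"
  by (induction xs) (auto simp: scaleR_add_right)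

lemma avg_swap:
  fixes f :: "'a \<Rightarrow> 'b \<Rightarrow> 'c::real_normed_vector"
  shows "avg xs (\<lambda>x. avg ys (\<lambda>y. f x y)) = avg ys (\<lambda>y. avg xs (\<lambda>x. f x y))"
proof -
  have "(\<Sum>x\<leftarrow>xs. \<Sum>y\<leftarrow>ys. f x y) = (\<Sum>y\<leftarrow>ys. \<Sum>x\<leftarrow>xs. f x y)"
    by (induction xs) (auto simp: sum_list_addf)
  then show ?thesis
    by (simp add: avg_def sum_list_scaleR mult.commute)
qed

text \<open>Fubini for the product of two averages: each \<open>y\<close> is combined with each
  \<open>x\<close> through \<open>h\<close>, so the concatenated list represents the product
  measure.\<close>

lemma avg_product:
  assumes "xs \<noteq> []"
  shows "avg (concat (map (\<lambda>y. map (h y) xs) ys)) f = avg ys (\<lambda>y. avg xs (\<lambda>x. f (h y x)))"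
proof -
  have "(\<Sum>z\<leftarrow>concat (map (\<lambda>y. map (h y) xs) ys). f z) = (\<Sum>y\<leftarrow>ys. \<Sum>x\<leftarrow>xs. f (h y x))"
    by (induction ys) (auto simp: o_def)
  moreover have "length (concat (map (\<lambda>y. map (h y) xs) ys)) = length ys * length xs"
    by (induction ys) auto
  ultimately show ?thesis
    by (simp add: avg_def sum_list_scaleR)
qed

text \<open>The points are chosen one after the other so that each new vector \<open>(g i x)\<^sub>i\<close> makes an
  obtuse angle with the sum of the previous ones; hence the sums have length \<open>O(sqrt T)\<close> only.\<close>

lemma greedy_sums:
  fixes g :: "'i \<Rightarrow> 'x \<Rightarrow> complex"
  assumes ex: "\<And>c. \<exists>x\<in>S. Re (\<Sum>i\<in>I. c i * g i x) \<le> 0"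
    and bd: "\<And>x. x \<in> S \<Longrightarrow> (\<Sum>i\<in>I. (cmod (g i x))\<^sup>2) \<le> R"
  shows "\<exists>xs. length xs = T \<and> set xs \<subseteq> S \<and> (\<Sum>i\<in>I. (cmod (\<Sum>x\<leftarrow>xs. g i x))\<^sup>2) \<le> real T * R"
proof (induction T)
  case 0
  show ?case by (intro exI[of _ "[]"]) simp
next
  case (Suc T)
  then obtain xs where xs: "length xs = T" "set xs \<subseteq> S"
    "(\<Sum>i\<in>I. (cmod (\<Sum>x\<leftarrow>xs. g i x))\<^sup>2) \<le> real T * R" by blast
  define V where "V = (\<lambda>i. \<Sum>x\<leftarrow>xs. g i x)"
  \<comment> \<open>Taking the conjugates of the current sums as coefficients turns the sign
    condition \<open>ex\<close> into a bound for the cross term of the expanded square.\<close>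
  obtain x where x: "x \<in> S" "Re (\<Sum>i\<in>I. cnj (V i) * g i x) \<le> 0" using ex[of "\<lambda>i. cnj (V i)"] by blast
  have sq: "(cmod (a + b))\<^sup>2 = (cmod a)\<^sup>2 + (cmod b)\<^sup>2 + 2 * Re (cnj b * a)" for a b
    unfolding cmod_power2 by (simp add: power2_eq_square algebra_simps)
  have "(\<Sum>i\<in>I. (cmod (g i x + V i))\<^sup>2)
      = (\<Sum>i\<in>I. (cmod (g i x))\<^sup>2) + (\<Sum>i\<in>I. (cmod (V i))\<^sup>2) + 2 * Re (\<Sum>i\<in>I. cnj (V i) * g i x)"
    unfolding sq by (simp only: sum.distrib sum_distrib_left Re_sum)
  also have "\<dots> \<le> R + real T * R + 0"
    using bd[OF x(1)] xs(3) x(2) by (simp add: V_def)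
  finally have "(\<Sum>i\<in>I. (cmod (\<Sum>y\<leftarrow>x # xs. g i y))\<^sup>2) \<le> real (Suc T) * R"
    by (simp add: V_def algebra_simps)
  with xs x show ?case by (intro exI[of _ "x # xs"]) auto
qed

text \<open>Division by \<open>T\<close> turns the \<open>sqrt T\<close> growth of the greedy sums
  into averages of order \<open>1 / sqrt T\<close>, simultaneously for all \<open>i\<close>. The
  hypothesis \<open>ex\<close> says that no real-linear functional is positive on all vectors
  \<open>(g i x)\<close>, the dual form of 0 lying near their convex hull.\<close>

lemma greedy_mean:
  fixes g :: "'i \<Rightarrow> 'x \<Rightarrow> complex"
  assumes fin: "finite I"
    and ex: "\<And>c. \<exists>x\<in>S. Re (\<Sum>i\<in>I. c i * g i x) \<le> 0"
    and bd: "\<And>i x. i \<in> I \<Longrightarrow> x \<in> S \<Longrightarrow> cmod (g i x) \<le> B"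
    and eps: "\<epsilon> > 0"
  shows "\<exists>xs. xs \<noteq> [] \<and> set xs \<subseteq> S \<and> (\<forall>i\<in>I. cmod (avg xs (g i)) \<le> \<epsilon>)"
proof -
  define R where "R = real (card I) * B\<^sup>2"
  have R: "(\<Sum>i\<in>I. (cmod (g i x))\<^sup>2) \<le> R" if "x \<in> S" for x
  proof -
    have "(\<Sum>i\<in>I. (cmod (g i x))\<^sup>2) \<le> (\<Sum>i\<in>I. B\<^sup>2)"
      using bd that by (intro sum_mono power_mono) auto
    then show ?thesis by (simp add: R_def)
  qed
  \<comment> \<open>\<open>T > R / \<epsilon>\<^sup>2\<close> gives
    \<open>T * R \<le> (T * \<epsilon>)\<^sup>2\<close>; \<open>T > 0\<close> keeps the list
    nonempty.\<close>
  obtain T :: nat where T: "T > R / \<epsilon>\<^sup>2" "T > 0"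
    using reals_Archimedean2[of "max 0 (R / \<epsilon>\<^sup>2)"] by auto
  obtain xs where xs: "length xs = T" "set xs \<subseteq> S"
    "(\<Sum>i\<in>I. (cmod (\<Sum>x\<leftarrow>xs. g i x))\<^sup>2) \<le> real T * R"
    using greedy_sums[OF ex R] by metis
  have "cmod (avg xs (g i)) \<le> \<epsilon>" if i: "i \<in> I" for i
  proof -
    have "(cmod (\<Sum>x\<leftarrow>xs. g i x))\<^sup>2 \<le> real T * R"
      using xs(3) member_le_sum[OF i, of "\<lambda>i. (cmod (\<Sum>x\<leftarrow>xs. g i x))\<^sup>2"] fin by auto
    also have "\<dots> \<le> real T * (real T * \<epsilon>\<^sup>2)"
      using T eps by (intro mult_left_mono) (auto simp: field_simps)
    also have "\<dots> = (real T * \<epsilon>)\<^sup>2" by (simp add: power2_eq_square)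
    finally have "cmod (\<Sum>x\<leftarrow>xs. g i x) \<le> real T * \<epsilon>"
      using power2_le_imp_le eps by (metis less_eq_real_def mult_nonneg_nonneg of_nat_0_le_iff)
    then show ?thesis using T(2) xs(1) by (simp add: avg_def field_simps)
  qed
  with xs T show ?thesis by (intro exI[of _ xs]) auto
qed

text \<open>Bessel's inequality for \<open>b\<close> in the product average: \<open>a\<close> and
  \<open>c\<close> are approximately its conditional means given \<open>y\<close> and given
  \<open>x\<close>, hence nearly its projections onto functions of one variable, and they are nearly
  orthogonal since \<open>a\<close> has mean close to 0. The inner products of \<open>b\<close> with
  \<open>a\<close>, of \<open>b\<close> with \<open>c\<close> and of \<open>a\<close> with
  \<open>c\<close> contribute the errors \<open>2 * \<epsilon>\<close>, \<open>2 * \<delta>\<close>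
  and \<open>2 * \<delta>\<close>.\<close>

lemma avg_norm_square_ge:
  fixes b :: "'a \<Rightarrow> 'b \<Rightarrow> complex"
  assumes ne: "ys \<noteq> []" "xs \<noteq> []"
    and a1: "\<And>y. y \<in> set ys \<Longrightarrow> cmod (a y) \<le> 1" and c1: "\<And>x. x \<in> set xs \<Longrightarrow> cmod (c x) \<le> 1"
    and ba: "\<And>y. y \<in> set ys \<Longrightarrow> cmod (avg xs (b y) - a y) \<le> \<epsilon>"
    and bc: "\<And>x. x \<in> set xs \<Longrightarrow> cmod (avg ys (\<lambda>y. b y x) - c x) \<le> \<delta>"
    and a0: "cmod (avg ys a) \<le> \<delta>"
  shows "avg ys (\<lambda>y. avg xs (\<lambda>x. (cmod (b y x))\<^sup>2))
    \<ge> avg ys (\<lambda>y. (cmod (a y))\<^sup>2) + avg xs (\<lambda>x. (cmod (c x))\<^sup>2) - (2 * \<epsilon> + 4 * \<delta>)"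
proof -
  let ?A = "avg ys (\<lambda>y. (cmod (a y))\<^sup>2)" and ?C = "avg xs (\<lambda>x. (cmod (c x))\<^sup>2)"
  have lin: "linear (\<lambda>z. Re (w * z))" for w
    by (simp add: linear_iff algebra_simps)
  have sc: "avg zs (\<lambda>z. r * h z) = r * avg zs h" for zs :: "'z list" and h and r :: real
    by (rule avg_linear) (simp add: linear_iff algebra_simps)
  \<comment> \<open>This is \<open>(cmod (u - (v + w)))\<^sup>2 \<ge> 0\<close>, applied below with \<open>v = a y\<close> and \<open>w = c x\<close>.\<close>
  have pt: "(cmod u)\<^sup>2 \<ge> 2 * Re (cnj v * u) + 2 * Re (cnj w * u) - (cmod v)\<^sup>2 - (cmod w)\<^sup>2
      - 2 * Re (cnj w * v)" for u v w
  proof -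
    have "(cmod (u - (v + w)))\<^sup>2 \<ge> 0" by simp
    then show ?thesis unfolding cmod_power2 by (simp add: power2_eq_square algebra_simps)
  qed
  have near: "Re (cnj w * u) \<ge> Re (cnj w * v) - d" if "cmod w \<le> 1" "cmod (u - v) \<le> d" for u v w d
  proof -
    have "\<bar>Re (cnj w * (u - v))\<bar> \<le> cmod (cnj w * (u - v))" by (rule abs_Re_le_cmod)
    also have "\<dots> \<le> 1 * d" unfolding norm_mult using that by (intro mult_mono) auto
    finally show ?thesis by (simp add: algebra_simps)
  qed
  have sq: "Re (cnj u * u) = (cmod u)\<^sup>2" for u
    unfolding cmod_power2 by (simp add: power2_eq_square)
  have "avg ys (\<lambda>y. Re (cnj (a y) * avg xs (b y))) \<ge> avg ys (\<lambda>y. (cmod (a y))\<^sup>2 - \<epsilon>)"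
    using near[OF a1 ba] by (intro avg_mono) (metis sq)
  then have 1: "avg ys (\<lambda>y. avg xs (\<lambda>x. Re (cnj (a y) * b y x))) \<ge> ?A - \<epsilon>"
    by (simp only: avg_linear[OF lin] avg_diff avg_const[OF ne(1)])
  have "avg xs (\<lambda>x. Re (cnj (c x) * avg ys (\<lambda>y. b y x))) \<ge> avg xs (\<lambda>x. (cmod (c x))\<^sup>2 - \<delta>)"
    using near[OF c1 bc] by (intro avg_mono) (metis sq)
  \<comment> \<open>Swapping the averages makes \<open>c x\<close> constant for the inner average,
    so linearity pulls it out.\<close>
  then have 2: "avg ys (\<lambda>y. avg xs (\<lambda>x. Re (cnj (c x) * b y x))) \<ge> ?C - \<delta>"
    by (subst avg_swap) (simp only: avg_linear[OF lin] avg_diff avg_const[OF ne(2)])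
  have "avg xs (\<lambda>x. Re (cnj (c x) * avg ys a)) \<le> avg xs (\<lambda>x. \<delta>)"
  proof (rule avg_mono)
    fix x assume x: "x \<in> set xs"
    have "Re (cnj (c x) * 0) \<ge> Re (cnj (c x) * avg ys a) - \<delta>"
      using near[OF c1[OF x], of 0 "avg ys a" \<delta>] a0 by simp
    then show "Re (cnj (c x) * avg ys a) \<le> \<delta>" by simp
  qed
  then have 3: "avg ys (\<lambda>y. avg xs (\<lambda>x. Re (cnj (c x) * a y))) \<le> \<delta>"
    by (subst avg_swap) (simp only: avg_linear[OF lin] avg_const[OF ne(2)])
  have "avg ys (\<lambda>y. avg xs (\<lambda>x. (cmod (b y x))\<^sup>2)) \<ge>
    avg ys (\<lambda>y. avg xs (\<lambda>x. 2 * Re (cnj (a y) * b y x) + 2 * Re (cnj (c x) * b y x) - (cmod (a y))\<^sup>2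
       - (cmod (c x))\<^sup>2 - 2 * Re (cnj (c x) * a y)))"
    by (intro avg_mono pt)
  also have "avg ys (\<lambda>y. avg xs (\<lambda>x. 2 * Re (cnj (a y) * b y x) + 2 * Re (cnj (c x) * b y x) - (cmod (a y))\<^sup>2
       - (cmod (c x))\<^sup>2 - 2 * Re (cnj (c x) * a y))) =
     2 * avg ys (\<lambda>y. avg xs (\<lambda>x. Re (cnj (a y) * b y x))) + 2 * avg ys (\<lambda>y. avg xs (\<lambda>x. Re (cnj (c x) * b y x)))
     - ?A - ?C - 2 * avg ys (\<lambda>y. avg xs (\<lambda>x. Re (cnj (c x) * a y)))"
    by (simp only: avg_add avg_diff sc avg_const[OF ne(1)] avg_const[OF ne(2)])
  finally show ?thesis using 1 2 3 by linarith
qed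

subsection \<open>A Bessel-type inequality on products of planar sets\<close>

text \<open>Uniform continuity reduces the compact family to a finite net \<open>N\<close> of
  parameters, to which \<open>greedy_mean\<close> applies; half of \<open>\<epsilon>\<close> is
  spent on the net and half on the averages.\<close>

lemma uniform_greedy_mean:
  fixes g :: "nat \<Rightarrow> 'a::metric_space \<Rightarrow> complex \<Rightarrow> complex"
  assumes A: "compact A" and C: "compact C" and S: "S \<subseteq> C"
    and cont: "\<And>k. k < n \<Longrightarrow> continuous_on (A \<times> C) (\<lambda>p. g k (fst p) (snd p))"
    and ex: "\<And>B c. finite B \<Longrightarrow> B \<subseteq> A \<times> {..<n} \<Longrightarrow>
      \<exists>x\<in>S. Re (\<Sum>p\<in>B. c p * g (snd p) (fst p) x) \<le> 0"
    and eps: "\<epsilon> > 0"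
  shows "\<exists>xs. xs \<noteq> [] \<and> set xs \<subseteq> S \<and> (\<forall>a\<in>A. \<forall>k<n. cmod (avg xs (g k a)) \<le> \<epsilon>)"
proof -
  have cAC: "compact (A \<times> C)" using A C by (rule compact_Times)
  have "\<exists>d>0. \<forall>a\<in>A. \<forall>a'\<in>A. \<forall>x\<in>C. dist a a' < d \<longrightarrow> cmod (g k a x - g k a' x) < \<epsilon> / 2"
    if k: "k < n" for k
  proof -
    have "uniformly_continuous_on (A \<times> C) (\<lambda>p. g k (fst p) (snd p))"
      using cont[OF k] cAC by (rule compact_uniformly_continuous)
    then obtain d where d: "d > 0" "\<And>p q. p \<in> A \<times> C \<Longrightarrow> q \<in> A \<times> C \<Longrightarrow> dist q p < d \<Longrightarrow>
        dist (g k (fst q) (snd q)) (g k (fst p) (snd p)) < \<epsilon> / 2"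
      unfolding uniformly_continuous_on_def using eps by (metis half_gt_zero)
    show ?thesis
    proof (intro exI[of _ d] conjI ballI impI d(1))
      fix a a' x assume "a \<in> A" "a' \<in> A" "x \<in> C" "dist a a' < d"
      with d(2)[of "(a', x)" "(a, x)"] show "cmod (g k a x - g k a' x) < \<epsilon> / 2"
        by (simp add: dist_Pair_Pair dist_norm)
    qed
  qed
  then obtain d where d: "\<And>k. k < n \<Longrightarrow> d k > 0"
    "\<And>k a a' x. k < n \<Longrightarrow> a \<in> A \<Longrightarrow> a' \<in> A \<Longrightarrow> x \<in> C \<Longrightarrow> dist a a' < d k \<Longrightarrow>
      cmod (g k a x - g k a' x) < \<epsilon> / 2"
    by metis
  \<comment> \<open>The element 1 keeps \<open>Min\<close> defined when \<open>n = 0\<close>; the 0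
    in \<open>M\<close> below has the same purpose.\<close>
  define \<delta> where "\<delta> = Min (insert 1 (d ` {..<n}))"
  have \<delta>: "\<delta> > 0" "\<And>k. k < n \<Longrightarrow> \<delta> \<le> d k"
    using d(1) by (auto simp: \<delta>_def)
  obtain N where N: "finite N" "N \<subseteq> A" "A \<subseteq> (\<Union>a\<in>N. ball a \<delta>)"
    using compactE_image[OF A, of A "\<lambda>a. ball a \<delta>"] \<delta>(1) by (force intro: centre_in_ball)
  have "bounded ((\<lambda>p. g k (fst p) (snd p)) ` (A \<times> C))" if "k < n" for k
    using compact_continuous_image[OF cont[OF that] cAC] by (rule compact_imp_bounded)
  then have "\<exists>b. \<forall>p\<in>A \<times> C. cmod (g k (fst p) (snd p)) \<le> b" if "k < n" for k
    using that unfolding bounded_iff by blast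
  then obtain b where b: "\<And>k p. k < n \<Longrightarrow> p \<in> A \<times> C \<Longrightarrow> cmod (g k (fst p) (snd p)) \<le> b k"
    by metis
  define M where "M = Max (insert 0 (b ` {..<n}))"
  have M: "b k \<le> M" if "k < n" for k using that by (auto simp: M_def)
  have "\<exists>xs. xs \<noteq> [] \<and> set xs \<subseteq> S \<and>
      (\<forall>p\<in>N \<times> {..<n}. cmod (avg xs (g (snd p) (fst p))) \<le> \<epsilon> / 2)"
  proof (rule greedy_mean[where B = M])
    show "finite (N \<times> {..<n})" using N by auto
    show "\<exists>x\<in>S. Re (\<Sum>p\<in>N \<times> {..<n}. c p * g (snd p) (fst p) x) \<le> 0" for c
      using N by (intro ex) auto
    fix p x assume "p \<in> N \<times> {..<n}" "x \<in> S"
    then show "cmod (g (snd p) (fst p) x) \<le> M"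
      using b[of "snd p" "(fst p, x)"] M[of "snd p"] N S by force
  qed (use eps in auto)
  then obtain xs where xs: "xs \<noteq> []" "set xs \<subseteq> S"
    "\<And>a k. a \<in> N \<Longrightarrow> k < n \<Longrightarrow> cmod (avg xs (g k a)) \<le> \<epsilon> / 2" by fastforce
  have "cmod (avg xs (g k a)) \<le> \<epsilon>" if a: "a \<in> A" and k: "k < n" for a k
  proof -
    obtain a' where a': "a' \<in> N" "dist a' a < \<delta>" using N a by auto
    have "cmod (avg xs (\<lambda>x. g k a x - g k a' x)) \<le> \<epsilon> / 2"
    proof (rule norm_avg_bound[OF xs(1)])
      fix x assume "x \<in> set xs"
      then show "cmod (g k a x - g k a' x) \<le> \<epsilon> / 2"
        using d(2)[OF k a, of a' x] a' N S xs(2) \<delta>(2)[OF k] by (force simp: dist_commute)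
    qed
    moreover have "avg xs (g k a) = avg xs (\<lambda>x. g k a x - g k a' x) + avg xs (g k a')"
      by (simp add: avg_diff)
    ultimately show ?thesis
      using xs(3)[OF a'(1) k] norm_triangle_ineq[of "avg xs (\<lambda>x. g k a x - g k a' x)" "avg xs (g k a')"]
      by simp
  qed
  with xs show ?thesis by blast
qed

text \<open>The coordinates from \<open>l\<close> on are pinned to 0, so that compact sets
  \<open>K i\<close> for \<open>i < l\<close> make this a product of compact sets over all
  indices.\<close>

definition box_upto :: "nat \<Rightarrow> (nat \<Rightarrow> complex set) \<Rightarrow> (nat \<Rightarrow> complex) set" where
  "box_upto l K = {z. (\<forall>i<l. z i \<in> K i) \<and> (\<forall>i\<ge>l. z i = 0)}"

lemma compact_box_upto:
  assumes "\<And>i. i < l \<Longrightarrow> compact (K i)"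
  shows "compact (box_upto l K)"
proof -
  have eq: "box_upto l K = PiE UNIV (\<lambda>i. if i < l then K i else {0})"
  proof (rule subset_antisym; rule subsetI)
    fix z assume "z \<in> PiE UNIV (\<lambda>i. if i < l then K i else {0})"
    then have z: "z i \<in> (if i < l then K i else {0})" for i
      unfolding PiE_UNIV_domain Pi_def by blast
    have "z i \<in> K i" if "i < l" for i using z[of i] that by simp
    moreover have "z i = 0" if "i \<ge> l" for i using z[of i] that by simp
    ultimately show "z \<in> box_upto l K" by (simp add: box_upto_def)
  qed (simp add: box_upto_def PiE_UNIV_domain)
  have "compactin (product_topology (\<lambda>i::nat. euclidean :: complex topology) UNIV) (box_upto l K)"
    unfolding eq compactin_PiE using assms by auto
  then show ?thesis by (simp add: euclidean_product_topology)
qed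

lemma continuous_on_fun_upd:
  fixes f :: "'a::topological_space \<Rightarrow> 'i \<Rightarrow> 'b::topological_space"
  assumes "continuous_on X f" "continuous_on X h"
  shows "continuous_on X (\<lambda>p. (f p)(j := h p))"
proof (rule continuous_on_coordinatewise_then_product)
  fix i show "continuous_on X (\<lambda>p. ((f p)(j := h p)) i)"
    using assms continuous_on_product_then_coordinatewise[OF assms(1), of i] by (cases "i = j") auto
qed

text \<open>The condition \<open>minp\<close> is the maximum principle in the form that greedy
  averaging asks for: it makes evaluation at 0 an approximate average over \<open>S j\<close>.
  Variables are then averaged one after the other; each of them raises the mean square of \<phi> by
  about \<open>r\<^sup>2\<close>, while \<open>bd\<close> caps it at 1.\<close>

lemma separately_holomorphic_bessel:
  fixes \<phi> :: "(nat \<Rightarrow> complex) \<Rightarrow> nat \<Rightarrow> complex"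
  assumes cpt: "\<And>j. j < l \<Longrightarrow> compact (K j)"
    and SK: "\<And>j. j < l \<Longrightarrow> S j \<subseteq> K j"
    and K0: "\<And>j. j < l \<Longrightarrow> 0 \<in> K j"
    and cont: "\<And>k. k < n \<Longrightarrow> continuous_on (box_upto l K) (\<lambda>z. \<phi> z k)"
    and holo: "\<And>z j k. z \<in> box_upto l K \<Longrightarrow> j < l \<Longrightarrow> k < n \<Longrightarrow>
      (\<lambda>x. \<phi> (z(j := x)) k) holomorphic_on U j"
    and minp: "\<And>j h. j < l \<Longrightarrow> h holomorphic_on U j \<Longrightarrow> \<exists>x\<in>S j. Re (h x) \<le> Re (h 0)"
    and bd: "\<And>z. z \<in> box_upto l K \<Longrightarrow> (\<Sum>k<n. (cmod (\<phi> z k))\<^sup>2) \<le> 1"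
    and zero: "\<And>k. k < n \<Longrightarrow> \<phi> (\<lambda>i. 0) k = 0"
    and low: "\<And>j x. j < l \<Longrightarrow> x \<in> S j \<Longrightarrow> r\<^sup>2 \<le> (\<Sum>k<n. (cmod (\<phi> ((\<lambda>i. 0)(j := x)) k))\<^sup>2)"
  shows "real l * r\<^sup>2 \<le> 1"
proof -
  let ?X = "box_upto l K"
  have z0: "(\<lambda>i. 0) \<in> ?X" using K0 by (auto simp: box_upto_def)
  have upd: "z(j := x) \<in> ?X" if "z \<in> ?X" "j < l" "x \<in> K j" for z j x
    using that by (auto simp: box_upto_def)
  have bd1: "cmod (\<phi> z k) \<le> 1" if "z \<in> ?X" "k < n" for z k
  proof -
    have "(cmod (\<phi> z k))\<^sup>2 \<le> (\<Sum>k<n. (cmod (\<phi> z k))\<^sup>2)"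
      using that by (intro member_le_sum) auto
    then have "(cmod (\<phi> z k))\<^sup>2 \<le> 1\<^sup>2" using bd[OF that(1)] by simp
    then show ?thesis by (rule power2_le_imp_le) simp
  qed
  have mean: "\<exists>xs. xs \<noteq> [] \<and> set xs \<subseteq> S j \<and>
      (\<forall>z\<in>?X. \<forall>k<n. cmod (avg xs (\<lambda>x. \<phi> (z(j := x)) k) - \<phi> (z(j := 0)) k) \<le> \<epsilon>)"
    if j: "j < l" and eps: "\<epsilon> > 0" for j \<epsilon>
  proof -
    have "\<exists>xs. xs \<noteq> [] \<and> set xs \<subseteq> S j \<and>
      (\<forall>z\<in>?X. \<forall>k<n. cmod (avg xs (\<lambda>x. \<phi> (z(j := x)) k - \<phi> (z(j := 0)) k)) \<le> \<epsilon>)"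
    proof (rule uniform_greedy_mean[OF compact_box_upto[OF cpt] cpt[OF j] SK[OF j] _ _ eps])
      fix k assume k: "k < n"
      have "continuous_on (?X \<times> K j) (\<lambda>p. \<phi> ((fst p)(j := h p)) k)"
        if "continuous_on (?X \<times> K j) h" "\<And>p. p \<in> ?X \<times> K j \<Longrightarrow> h p \<in> K j" for h
      proof (rule continuous_on_compose2[OF cont[OF k]])
        show "continuous_on (?X \<times> K j) (\<lambda>p. (fst p)(j := h p))"
          by (intro continuous_on_fun_upd continuous_on_fst continuous_on_id that(1))
        show "(\<lambda>p. (fst p)(j := h p)) ` (?X \<times> K j) \<subseteq> ?X"
          using that(2) j by (intro image_subsetI upd) auto
      qed
      from this[of snd, OF continuous_on_snd[OF continuous_on_id]] this[of "\<lambda>p. 0"]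
      show "continuous_on (?X \<times> K j) (\<lambda>p. \<phi> ((fst p)(j := snd p)) k - \<phi> ((fst p)(j := 0)) k)"
        using K0[OF j] by (intro continuous_on_diff) auto
    next
      fix B c assume B: "finite B" "B \<subseteq> ?X \<times> {..<n}"
      \<comment> \<open>Subtracting the values at \<open>x = 0\<close> gives \<open>h 0 = 0\<close>,
        so \<open>minp\<close> yields a point of \<open>S j\<close> where the real part is
        nonpositive.\<close>
      define h where "h = (\<lambda>x. \<Sum>p\<in>B. c p * (\<phi> ((fst p)(j := x)) (snd p) - \<phi> ((fst p)(j := 0)) (snd p)))"
      have "h holomorphic_on U j"
        unfolding h_def using B j by (intro holomorphic_intros holo) auto
      from minp[OF j this] show "\<exists>x\<in>S j. Re (\<Sum>p\<in>B. c p *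
          (\<phi> ((fst p)(j := x)) (snd p) - \<phi> ((fst p)(j := 0)) (snd p))) \<le> 0"
        by (simp add: h_def)
    qed
    then obtain xs where xs: "xs \<noteq> []" "set xs \<subseteq> S j"
      "\<And>z k. z \<in> ?X \<Longrightarrow> k < n \<Longrightarrow> cmod (avg xs (\<lambda>x. \<phi> (z(j := x)) k - \<phi> (z(j := 0)) k)) \<le> \<epsilon>" by blast
    then show ?thesis
      by (intro exI[of _ xs]) (simp add: avg_diff avg_const[OF xs(1)])
  qed
  \<comment> \<open>One induction step below loses
    \<open>2 * \<epsilon> + 4 * (l * \<epsilon>)\<close> in each of the \<open>n\<close> components;
    \<open>C\<close> collects this loss.\<close>
  define C where "C = real n * (2 + 4 * real l)"
  have main: "real l * (r\<^sup>2 - C * \<epsilon>) \<le> 1" if eps: "\<epsilon> > 0" for \<epsilon>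
  proof -
    \<comment> \<open>\<open>ys\<close> represents the product of the averages in the first \<open>t\<close> variables.\<close>
    define P where "P = (\<lambda>t ys. ys \<noteq> [] \<and> set ys \<subseteq> ?X \<and> (\<forall>y\<in>set ys. \<forall>i\<ge>t. y i = 0) \<and>
      (\<forall>z\<in>?X. \<forall>k<n. cmod (avg ys (\<lambda>y. \<phi> (\<lambda>i. if i < t then y i else z i) k)
          - \<phi> (\<lambda>i. if i < t then 0 else z i) k) \<le> real t * \<epsilon>) \<and>
      avg ys (\<lambda>y. \<Sum>k<n. (cmod (\<phi> y k))\<^sup>2) \<ge> real t * (r\<^sup>2 - C * \<epsilon>))"
    have "t \<le> l \<Longrightarrow> \<exists>ys. P t ys" for t
    proof (induction t)
      case 0
      have "P 0 [\<lambda>i. 0]" using z0 by (simp add: P_def avg_def zero)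
      then show ?case by blast
    next
      case (Suc t)
      then obtain ys where "P t ys" and t: "t < l" by auto
      then have ys: "ys \<noteq> []" "set ys \<subseteq> ?X" "\<And>y i. y \<in> set ys \<Longrightarrow> i \<ge> t \<Longrightarrow> y i = 0"
        and ysm: "\<And>z k. z \<in> ?X \<Longrightarrow> k < n \<Longrightarrow> cmod (avg ys (\<lambda>y. \<phi> (\<lambda>i. if i < t then y i else z i) k)
          - \<phi> (\<lambda>i. if i < t then 0 else z i) k) \<le> real t * \<epsilon>"
        and ysq: "avg ys (\<lambda>y. \<Sum>k<n. (cmod (\<phi> y k))\<^sup>2) \<ge> real t * (r\<^sup>2 - C * \<epsilon>)"
        unfolding P_def by blast+
      obtain xs where xs: "xs \<noteq> []" "set xs \<subseteq> S t"
        "\<And>z k. z \<in> ?X \<Longrightarrow> k < n \<Longrightarrow> cmod (avg xs (\<lambda>x. \<phi> (z(t := x)) k) - \<phi> (z(t := 0)) k) \<le> \<epsilon>"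
        using mean[OF t eps] by blast
      have xsK: "x \<in> K t" if "x \<in> set xs" for x using that xs(2) SK[OF t] by blast
      \<comment> \<open>Each old point is extended by all of \<open>xs\<close> in the coordinate
        \<open>t\<close>, which is still 0 on \<open>ys\<close>: the product of the old average with
        the new one.\<close>
      define us where "us = concat (map (\<lambda>y. map (\<lambda>x. y(t := x)) xs) ys)"
      have avgus: "avg us f = avg ys (\<lambda>y. avg xs (\<lambda>x. f (y(t := x))))" for f :: "_ \<Rightarrow> 'z::real_normed_vector"
        unfolding us_def by (rule avg_product[OF xs(1)])
      have "us \<noteq> []" using ys(1) xs(1) by (auto simp: us_def neq_Nil_conv)
      moreover have "set us \<subseteq> ?X"
        using ys(2) xsK t by (auto simp: us_def intro!: upd)
      moreover have "\<forall>y\<in>set us. \<forall>i\<ge>Suc t. y i = 0"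
        using ys(3) by (auto simp: us_def)
      moreover have "cmod (avg us (\<lambda>y. \<phi> (\<lambda>i. if i < Suc t then y i else z i) k)
          - \<phi> (\<lambda>i. if i < Suc t then 0 else z i) k) \<le> real (Suc t) * \<epsilon>"
        if z: "z \<in> ?X" and k: "k < n" for z k
      proof -
        define w where "w = (\<lambda>y i. if i < t then y i else z i :: complex)"
        have w: "w y \<in> ?X" if "y \<in> set ys" for y
          using that ys(2) z by (auto simp: w_def box_upto_def)
        have e1: "(\<lambda>i. if i < Suc t then (y(t := x)) i else z i) = (w y)(t := x)" for y x
          by (auto simp: w_def fun_eq_iff)
        have e2: "(\<lambda>i. if i < t then y i else (z(t := 0)) i) = (w y)(t := 0)" for y
          by (auto simp: w_def fun_eq_iff)
        have e3: "(\<lambda>i. if i < t then 0 else (z(t := 0)) i) = (\<lambda>i. if i < Suc t then 0 else z i)"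
          by (auto simp: fun_eq_iff)
        \<comment> \<open>First the variable \<open>t\<close> is averaged to 0 at cost
          \<open>\<epsilon>\<close>. The next estimate, the induction hypothesis at
          \<open>z(t := 0)\<close>, averages the earlier variables to 0 at cost
          \<open>t * \<epsilon>\<close>.\<close>
        have "cmod (avg ys (\<lambda>y. avg xs (\<lambda>x. \<phi> ((w y)(t := x)) k) - \<phi> ((w y)(t := 0)) k)) \<le> \<epsilon>"
          by (rule norm_avg_bound[OF ys(1)]) (rule xs(3)[OF w k])
        moreover have "cmod (avg ys (\<lambda>y. \<phi> ((w y)(t := 0)) k)
            - \<phi> (\<lambda>i. if i < Suc t then 0 else z i) k) \<le> real t * \<epsilon>"
          using ysm[OF upd[OF z t K0[OF t]] k] unfolding e3 unfolding e2 .
        ultimately have "cmod ((avg ys (\<lambda>y. avg xs (\<lambda>x. \<phi> ((w y)(t := x)) k)) - avg ys (\<lambda>y. \<phi> ((w y)(t := 0)) k))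
          + (avg ys (\<lambda>y. \<phi> ((w y)(t := 0)) k) - \<phi> (\<lambda>i. if i < Suc t then 0 else z i) k)) \<le> \<epsilon> + real t * \<epsilon>"
          unfolding avg_diff by (rule norm_triangle_mono)
        then show ?thesis unfolding avgus e1 by (simp add: algebra_simps)
      qed
      moreover have "avg us (\<lambda>y. \<Sum>k<n. (cmod (\<phi> y k))\<^sup>2) \<ge> real (Suc t) * (r\<^sup>2 - C * \<epsilon>)"
      proof -
        let ?c = "\<lambda>x. (\<lambda>i. 0)(t := x)"
        have cX: "?c x \<in> ?X" if "x \<in> set xs" for x using upd[OF z0 t xsK[OF that]] .
        \<comment> \<open>Bessel's inequality with \<open>a y\<close> the value where variable
          \<open>t\<close> is 0 and \<open>c x\<close> the value on axis \<open>t\<close>. Means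
          over \<open>ys\<close> are known up to \<open>t * \<epsilon>\<close>, which is enlarged to
          \<open>l * \<epsilon>\<close> so that the loss does not depend on
          \<open>t\<close>.\<close>
        have "avg ys (\<lambda>y. (cmod (\<phi> y k))\<^sup>2) + avg xs (\<lambda>x. (cmod (\<phi> (?c x) k))\<^sup>2) - (2 * \<epsilon> + 4 * (real l * \<epsilon>))
          \<le> avg us (\<lambda>y. (cmod (\<phi> y k))\<^sup>2)" if k: "k < n" for k
          unfolding avgus
        proof (rule avg_norm_square_ge[OF ys(1) xs(1)])
          have tl: "real t * \<epsilon> \<le> real l * \<epsilon>" using t eps by (intro mult_right_mono) auto
          show "cmod (\<phi> y k) \<le> 1" if "y \<in> set ys" for y using bd1 ys(2) that k by blast
          show "cmod (\<phi> (?c x) k) \<le> 1" if "x \<in> set xs" for x using bd1[OF cX[OF that] k] .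
          show "cmod (avg xs (\<lambda>x. \<phi> (y(t := x)) k) - \<phi> y k) \<le> \<epsilon>" if y: "y \<in> set ys" for y
          proof -
            have "y(t := 0) = y" using ys(3)[OF y, of t] by (auto simp: fun_eq_iff)
            then show ?thesis using xs(3)[of y k] ys(2) y k by auto
          qed
          show "cmod (avg ys (\<lambda>y. \<phi> (y(t := x)) k) - \<phi> (?c x) k) \<le> real l * \<epsilon>" if x: "x \<in> set xs" for x
          proof -
            have "avg ys (\<lambda>y. \<phi> (y(t := x)) k) = avg ys (\<lambda>y. \<phi> (\<lambda>i. if i < t then y i else ?c x i) k)"
            proof (rule avg_cong)
              fix y assume y: "y \<in> set ys"
              have "y(t := x) = (\<lambda>i. if i < t then y i else ?c x i)"
                using ys(3)[OF y] by (auto simp: fun_eq_iff)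
              then show "\<phi> (y(t := x)) k = \<phi> (\<lambda>i. if i < t then y i else ?c x i) k" by simp
            qed
            moreover have "(\<lambda>i. if i < t then 0 else ?c x i) = ?c x" by (auto simp: fun_eq_iff)
            ultimately show ?thesis using ysm[OF cX[OF x] k] tl by simp
          qed
          have "avg ys (\<lambda>y. \<phi> y k) = avg ys (\<lambda>y. \<phi> (\<lambda>i. if i < t then y i else 0) k)"
          proof (rule avg_cong)
            fix y assume y: "y \<in> set ys"
            have "(\<lambda>i. if i < t then y i else 0) = y" using ys(3)[OF y] by (auto simp: fun_eq_iff)
            then show "\<phi> y k = \<phi> (\<lambda>i. if i < t then y i else 0) k" by simp
          qed
          then show "cmod (avg ys (\<lambda>y. \<phi> y k)) \<le> real l * \<epsilon>"
            using ysm[OF z0 k] tl by (simp add: zero[OF k])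
        qed
        then have "(\<Sum>k<n. avg ys (\<lambda>y. (cmod (\<phi> y k))\<^sup>2) + avg xs (\<lambda>x. (cmod (\<phi> (?c x) k))\<^sup>2)
            - (2 * \<epsilon> + 4 * (real l * \<epsilon>))) \<le> (\<Sum>k<n. avg us (\<lambda>y. (cmod (\<phi> y k))\<^sup>2))"
          by (intro sum_mono) auto
        then have "avg ys (\<lambda>y. \<Sum>k<n. (cmod (\<phi> y k))\<^sup>2) + avg xs (\<lambda>x. \<Sum>k<n. (cmod (\<phi> (?c x) k))\<^sup>2) - C * \<epsilon>
          \<le> avg us (\<lambda>y. \<Sum>k<n. (cmod (\<phi> y k))\<^sup>2)"
          by (simp add: avg_sum sum.distrib sum_subtractf C_def algebra_simps)
        moreover have "avg xs (\<lambda>x. r\<^sup>2) \<le> avg xs (\<lambda>x. \<Sum>k<n. (cmod (\<phi> (?c x) k))\<^sup>2)"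
          using xs(2) by (intro avg_mono low[OF t]) auto
        ultimately show ?thesis using ysq by (simp add: avg_const[OF xs(1)] algebra_simps)
      qed
      ultimately have "P (Suc t) us" unfolding P_def by blast
      then show ?case by blast
    qed
    then obtain ys where "P l ys" by blast
    then have ys: "ys \<noteq> []" "set ys \<subseteq> ?X" "avg ys (\<lambda>y. \<Sum>k<n. (cmod (\<phi> y k))\<^sup>2) \<ge> real l * (r\<^sup>2 - C * \<epsilon>)"
      unfolding P_def by blast+
    have "avg ys (\<lambda>y. \<Sum>k<n. (cmod (\<phi> y k))\<^sup>2) \<le> avg ys (\<lambda>y. 1)"
      using ys(2) by (intro avg_mono bd) auto
    with ys show ?thesis by (simp add: avg_const)
  qed
  \<comment> \<open>The bound holds for every positive \<open>\<epsilon>\<close> with the same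
    \<open>C\<close>, so \<open>\<epsilon>\<close> may tend to 0 from the right.\<close>
  show ?thesis
  proof (rule tendsto_upperbound)
    have "((\<lambda>\<epsilon>. real l * (r\<^sup>2 - C * \<epsilon>)) \<longlongrightarrow> real l * (r\<^sup>2 - C * 0)) (at_right 0)"
      by (intro tendsto_intros)
    then show "((\<lambda>\<epsilon>. real l * (r\<^sup>2 - C * \<epsilon>)) \<longlongrightarrow> real l * r\<^sup>2) (at_right 0)" by simp
    show "\<forall>\<^sub>F \<epsilon> in at_right 0. real l * (r\<^sup>2 - C * \<epsilon>) \<le> 1"
      using main by (auto simp: eventually_at_right_less eventually_at_filter)
  qed simp
qed

subsection \<open>Level sets and the maximum principle\<close>

text \<open>Otherwise \<open>Re h\<close> would exceed \<open>Re (h \<xi>)\<close> by a fixed amount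
  on the compact level set. This set contains the frontier of the bounded open set where
  \<open>u < r\<close>, so the maximum principle for \<open>- h\<close> is contradicted at
  \<xi>.\<close>

lemma exists_Re_le_on_level_set:
  assumes U: "open U" and u: "continuous_on U u" and K: "compact {x \<in> U. u x \<le> (r::real)}"
    and \<xi>: "\<xi> \<in> U" "u \<xi> < r" and h: "h holomorphic_on U"
  shows "\<exists>x\<in>{x \<in> U. u x = r}. Re (h x) \<le> Re (h \<xi>)"
proof (rule ccontr)
  let ?K = "{x \<in> U. u x \<le> r}" and ?S = "{x \<in> U. u x = r}" and ?W = "{x \<in> U. u x < r}"
  assume "\<not> ?thesis"
  then have gt: "Re (h x) > Re (h \<xi>)" if "x \<in> ?S" for x using that by force
  have uK: "continuous_on ?K u" and hK: "continuous_on ?K h"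
    using u holomorphic_on_imp_continuous_on[OF h] by (auto elim!: continuous_on_subset)
  have "?S = ?K \<inter> u -` {r}" by auto
  moreover have "closed (?K \<inter> u -` {r})"
    by (rule continuous_closed_preimage[OF uK compact_imp_closed[OF K]]) simp
  ultimately have "compact ?S" using K by (metis compact_Int_closed inf_left_idem)
  have "\<exists>b>Re (h \<xi>). \<forall>x\<in>?S. b \<le> Re (h x)"
  \<comment> \<open>For an empty level set any bound above \<open>Re (h \<xi>)\<close> serves, and
    the contradiction below rules this case out too.\<close>
  proof (cases "?S = {}")
    case True
    then show ?thesis by (metis empty_iff less_add_one)
  next
    case False
    have "continuous_on ?S (\<lambda>x. Re (h x))"
      using hK by (intro continuous_on_Re) (auto elim!: continuous_on_subset)
    from continuous_attains_inf[OF \<open>compact ?S\<close> False this] gt show ?thesis by blast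
  qed
  then obtain b where b: "b > Re (h \<xi>)" "\<And>x. x \<in> ?S \<Longrightarrow> b \<le> Re (h x)" by blast
  have oW: "open ?W"
  proof -
    have "?W = U \<inter> u -` {..<r}" by auto
    then show ?thesis using continuous_open_preimage[OF u U, of "{..<r}"] by simp
  qed
  have clW: "closure ?W \<subseteq> ?K"
    by (rule closure_minimal[OF _ compact_imp_closed[OF K]]) auto
  have "Re (- h \<xi>) \<le> - b"
  proof (rule maximum_real_frontier[of "\<lambda>x. - h x" ?W])
    show "(\<lambda>x. - h x) holomorphic_on interior ?W"
      using h oW by (intro holomorphic_on_minus) (auto simp: interior_open elim: holomorphic_on_subset)
    show "continuous_on (closure ?W) (\<lambda>x. - h x)"
      using hK clW by (intro continuous_on_minus) (rule continuous_on_subset)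
    show "bounded ?W" using compact_imp_bounded[OF K] by (rule bounded_subset) auto
    show "\<xi> \<in> ?W" using \<xi> by simp
    fix z assume "z \<in> frontier ?W"
    \<comment> \<open>Frontier points lie in the closed set where \<open>u \<le> r\<close> but
      outside the open set where \<open>u < r\<close>.\<close>
    then have "z \<in> ?S" using clW oW by (force simp: frontier_def interior_open)
    then show "Re (- h z) \<le> - b" using b(2) by simp
  qed
  with b(1) show False by simp
qed

subsection \<open>Invariance of domain and holomorphy in the coordinate spaces\<close>

text \<open>Brouwer's invariance of domain, transported from real dimension
  \<open>2 * n\<close>.\<close>

lemma openin_image_Cn:
  assumes U: "openin (top_of_set (Cn n)) U" and f: "continuous_on U f" "f ` U \<subseteq> Cn n" "inj_on f U"
  shows "openin (top_of_set (Cn n)) (f ` U)"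
proof -
  \<comment> \<open>\<open>\<rho>\<close> interleaves real and imaginary parts and identifies \<open>Cn n\<close> with real \<open>2n\<close>-space.\<close>
  define \<rho> where "\<rho> = (\<lambda>(z :: nat \<Rightarrow> complex) i. if even i then Re (z (i div 2)) else Im (z (i div 2)))"
  define \<gamma> where "\<gamma> = (\<lambda>(x :: nat \<Rightarrow> real) i. Complex (x (2 * i)) (x (2 * i + 1)))"
  define E where "E = {x :: nat \<Rightarrow> real. \<forall>i\<ge>2 * n. x i = 0}"
  have \<gamma>\<rho>: "\<gamma> (\<rho> z) = z" for z by (simp add: \<gamma>_def \<rho>_def)
  have \<rho>\<gamma>: "\<rho> (\<gamma> x) = x" for x
    by (auto simp: \<gamma>_def \<rho>_def fun_eq_iff elim!: evenE oddE)
  have \<rho>E: "\<rho> z \<in> E" if "z \<in> Cn n" for z using that by (auto simp: \<rho>_def E_def Cn_def)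
  have \<gamma>C: "\<gamma> x \<in> Cn n" if "x \<in> E" for x
    using that by (auto simp: \<gamma>_def E_def Cn_def complex_eq_iff)
  have co: "continuous_on X (\<lambda>z :: nat \<Rightarrow> 'b::topological_space. z i)" for X i
    using continuous_on_product_coordinates by (rule continuous_on_subset) simp
  have c\<rho>: "continuous_on X \<rho>" for X
  proof (rule continuous_on_coordinatewise_then_product)
    fix i show "continuous_on X (\<lambda>z. \<rho> z i)"
      unfolding \<rho>_def
      by (cases "even i") (simp_all add: co continuous_on_Re continuous_on_Im)
  qed
  have c\<gamma>: "continuous_on X \<gamma>" for X
  proof (rule continuous_on_coordinatewise_then_product)
    fix i show "continuous_on X (\<lambda>x. \<gamma> x i)"
      unfolding \<gamma>_def Complex_eq
      by (intro continuous_on_add continuous_on_mult continuous_on_const continuous_on_of_real co)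
  qed
  have Eu: "Euclidean_space (2 * n) = top_of_set E"
    by (simp add: Euclidean_space_def E_def euclidean_product_topology)
  have UC: "U \<subseteq> Cn n" using U openin_imp_subset by blast
  have U': "\<rho> ` U = E \<inter> \<gamma> -` U"
    using UC \<rho>E by (auto simp: \<gamma>\<rho>) (metis \<rho>\<gamma> image_eqI)
  have oU': "openin (top_of_set E) (\<rho> ` U)"
    unfolding U' by (rule continuous_openin_preimage[OF c\<gamma> _ U]) (use \<gamma>C in auto)
  let ?f = "\<lambda>x. \<rho> (f (\<gamma> x))"
  have "openin (top_of_set E) (?f ` (\<rho> ` U))"
    unfolding Eu[symmetric]
  proof (rule invariance_of_domain_Euclidean_space)
    show "openin (Euclidean_space (2 * n)) (\<rho> ` U)" using oU' by (simp add: Eu)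
    have "\<rho> ` U \<subseteq> E" using UC \<rho>E by auto
    moreover have "continuous_on (\<rho> ` U) ?f"
      by (intro continuous_on_compose2[OF c\<rho>[of UNIV]] continuous_on_compose2[OF f(1)] c\<gamma>)
         (auto simp: \<gamma>\<rho>)
    moreover have "?f ` \<rho> ` U \<subseteq> E" using f(2) \<rho>E by (auto simp: \<gamma>\<rho>)
    ultimately show "continuous_map (subtopology (Euclidean_space (2 * n)) (\<rho> ` U)) (Euclidean_space (2 * n)) ?f"
      by (auto simp: Eu subtopology_subtopology Int_absorb1 image_subset_iff_funcset)
    show "inj_on ?f (\<rho> ` U)"
      using f(3) by (auto simp: inj_on_def \<gamma>\<rho>) (metis \<gamma>\<rho>)
  qed
  then have o: "openin (top_of_set E) (\<rho> ` f ` U)" by (simp add: image_image \<gamma>\<rho>)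
  have "openin (top_of_set (Cn n)) (Cn n \<inter> \<rho> -` (\<rho> ` f ` U))"
    by (rule continuous_openin_preimage[OF c\<rho> _ o]) (use \<rho>E in auto)
  moreover have "Cn n \<inter> \<rho> -` (\<rho> ` f ` U) = f ` U"
    using f(2) by auto (metis \<gamma>\<rho> image_eqI)
  ultimately show ?thesis by simp
qed

text \<open>Restrictions of \<open>f\<close> to relatively open subsets are again continuous and
  injective, so invariance of domain makes \<open>f\<close> open onto its image. Compact balls in
  the image thus pull back to compact sets.\<close>

lemma continuous_inverse_Cn:
  assumes D: "openin (top_of_set (Cn n)) D"
    and f: "continuous_on D f" "f ` D \<subseteq> Cn n" "inj_on f D"
  shows "continuous_on (f ` D) (inv_into D f)"
proof (rule continuous_on_inverse_open_map[OF f(1) refl])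
  show "inv_into D f (f x) = x" if "x \<in> D" for x using that f(3) by simp
  fix U assume U: "openin (top_of_set D) U"
  then have UD: "U \<subseteq> D" by (rule openin_imp_subset)
  have "openin (top_of_set (Cn n)) U" using D U by (rule openin_trans[rotated])
  then have "openin (top_of_set (Cn n)) (f ` U)"
    using f UD by (intro openin_image_Cn) (auto elim: continuous_on_subset inj_on_subset)
  then show "openin (top_of_set (f ` D)) (f ` U)"
    by (rule openin_subset_trans) (use f(2) UD in auto)
qed

section \<open>Complex differentiability, continuity and the chain rule along curves\<close>

lemma cnorm_tendsto:
  assumes "\<And>i. i < n \<Longrightarrow> ((\<lambda>x. f x i) \<longlongrightarrow> l i) F"
  shows "((\<lambda>x. cnorm n (f x)) \<longlongrightarrow> cnorm n l) F"
  unfolding cnorm_def L2_set_def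
  by (intro tendsto_intros) (use assms in auto)

text \<open>Membership in \<open>Cn n\<close> settles the coordinates that \<open>cnorm n\<close>
  does not see; the denominators of difference quotients are therefore nonzero away from the base
  point.\<close>

lemma cnorm_diff_eq_0_iff:
  assumes "z \<in> Cn n" "w \<in> Cn n"
  shows "cnorm n (\<lambda>i. w i - z i) = 0 \<longleftrightarrow> w = z"
proof
  assume 0: "cnorm n (\<lambda>i. w i - z i) = 0"
  show "w = z"
  proof (rule ext)
    fix i show "w i = z i"
      using 0 assms by (cases "i < n") (auto simp: cnorm_def L2_set_eq_0_iff Cn_def)
  qed
qed (simp add: cnorm_def L2_set_eq_0_iff)

lemma coordinate_tendsto:
  fixes z :: "'i \<Rightarrow> 'b::topological_space"
  shows "((\<lambda>w. w i) \<longlongrightarrow> z i) (at z within D)"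
  using continuous_on_product_then_coordinatewise[of D "\<lambda>w. w"]
    continuous_on_product_coordinates[of i]
  by (metis continuous_on_def UNIV_I tendsto_within_subset subset_UNIV)

lemma complex_differentiable_at_imp_continuous:
  assumes g: "complex_differentiable_at n D g z" and D: "D \<subseteq> Cn n" and z: "z \<in> D"
  shows "(g \<longlongrightarrow> g z) (at z within D)"
proof -
  obtain a where a: "((\<lambda>w. cmod (g w - g z - (\<Sum>i<n. a i * (w i - z i))) / cnorm n (\<lambda>i. w i - z i))
           \<longlongrightarrow> 0) (at z within D)"
    using g unfolding complex_differentiable_at_def by blast
  have co: "((\<lambda>w. w i) \<longlongrightarrow> z i) (at z within D)" for i by (rule coordinate_tendsto)
  have "((\<lambda>w. cnorm n (\<lambda>i. w i - z i)) \<longlongrightarrow> cnorm n (\<lambda>i. z i - z i)) (at z within D)"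
    by (intro cnorm_tendsto tendsto_intros co)
  from tendsto_mult[OF a this]
  have "((\<lambda>w. cmod (g w - g z - (\<Sum>i<n. a i * (w i - z i))) / cnorm n (\<lambda>i. w i - z i) *
      cnorm n (\<lambda>i. w i - z i)) \<longlongrightarrow> 0) (at z within D)" by simp
  \<comment> \<open>For \<open>w\<close> in \<open>D\<close> other than \<open>z\<close> the norm in
    the denominator is nonzero and cancels.\<close>
  moreover have "\<forall>\<^sub>F w in at z within D. cmod (g w - g z - (\<Sum>i<n. a i * (w i - z i))) / cnorm n (\<lambda>i. w i - z i) *
      cnorm n (\<lambda>i. w i - z i) = cmod (g w - g z - (\<Sum>i<n. a i * (w i - z i)))"
    unfolding eventually_at_filter using cnorm_diff_eq_0_iff[of z n] z D by (auto simp: subset_iff)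
  ultimately have "((\<lambda>w. cmod (g w - g z - (\<Sum>i<n. a i * (w i - z i)))) \<longlongrightarrow> 0) (at z within D)"
    by (rule Lim_transform_eventually)
  then have "((\<lambda>w. g w - g z - (\<Sum>i<n. a i * (w i - z i))) \<longlongrightarrow> 0) (at z within D)"
    by (rule tendsto_norm_zero_cancel)
  moreover have "((\<lambda>w. g z + (\<Sum>i<n. a i * (w i - z i))) \<longlongrightarrow> g z + (\<Sum>i<n. a i * (z i - z i))) (at z within D)"
    by (intro tendsto_intros co)
  ultimately have "((\<lambda>w. (g w - g z - (\<Sum>i<n. a i * (w i - z i))) + (g z + (\<Sum>i<n. a i * (w i - z i))))
      \<longlongrightarrow> 0 + (g z + (\<Sum>i<n. a i * (z i - z i)))) (at z within D)"
    by (rule tendsto_add)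
  then show ?thesis by (simp add: algebra_simps)
qed

lemma holomorphic_map_imp_continuous_on:
  assumes f: "holomorphic_map n k D f" and D: "D \<subseteq> Cn n"
  shows "continuous_on D f"
proof (rule continuous_on_coordinatewise_then_product)
  fix i
  show "continuous_on D (\<lambda>z. f z i)"
  proof (cases "i < k")
    case True
    then show ?thesis unfolding continuous_on_def
      using f complex_differentiable_at_imp_continuous[OF _ D, of "\<lambda>w. f w i"]
      by (auto simp: holomorphic_map_def)
  next
    case False
    then have "f z i = 0" if "z \<in> D" for z
      using f that by (auto simp: holomorphic_map_def Cn_def)
    then show ?thesis using continuous_on_cong[of D D "\<lambda>z. f z i" "\<lambda>z. 0"] by simp
  qed
qed

text \<open>Chain rule: the derivative at \<open>\<zeta>0\<close> is
  \<open>\<Sum>i<n. a i * d i\<close>. The remainder of the linear approximation, divided by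
  \<open>\<zeta> - \<zeta>0\<close>, has modulus \<open>Q (\<gamma> \<zeta>)\<close> times the norm
  of the difference quotients of \<gamma>, a null function times a convergent one.\<close>

lemma holomorphic_on_compose_curve:
  assumes D: "D \<subseteq> Cn n" and g: "\<And>z. z \<in> D \<Longrightarrow> complex_differentiable_at n D g z"
    and V: "open V" and \<gamma>: "continuous_on V \<gamma>" "\<gamma> ` V \<subseteq> D"
    and hol: "\<And>i. i < n \<Longrightarrow> (\<lambda>\<zeta>. \<gamma> \<zeta> i) holomorphic_on V"
  shows "(\<lambda>\<zeta>. g (\<gamma> \<zeta>)) holomorphic_on V"
  unfolding holomorphic_on_open[OF V]
proof
  fix \<zeta>0 assume \<zeta>0: "\<zeta>0 \<in> V"
  let ?z = "\<gamma> \<zeta>0"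
  have z: "?z \<in> D" using \<gamma> \<zeta>0 by auto
  obtain a where a: "((\<lambda>w. cmod (g w - g ?z - (\<Sum>i<n. a i * (w i - ?z i))) / cnorm n (\<lambda>i. w i - ?z i))
           \<longlongrightarrow> 0) (at ?z within D)"
    using g[OF z] unfolding complex_differentiable_at_def by blast
  define Q where "Q = (\<lambda>w. cmod (g w - g ?z - (\<Sum>i<n. a i * (w i - ?z i))) / cnorm n (\<lambda>i. w i - ?z i))"
  have "\<exists>d. ((\<lambda>\<zeta>. \<gamma> \<zeta> i) has_field_derivative d) (at \<zeta>0)" if "i < n" for i
    using hol[OF that] V \<zeta>0 by (simp add: holomorphic_on_open)
  then obtain d where d: "\<And>i. i < n \<Longrightarrow> ((\<lambda>\<zeta>. \<gamma> \<zeta> i) has_field_derivative d i) (at \<zeta>0)" by metis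
  then have d': "((\<lambda>\<zeta>. (\<gamma> \<zeta> i - ?z i) / (\<zeta> - \<zeta>0)) \<longlongrightarrow> d i) (at \<zeta>0)" if "i < n" for i
    using that by (simp add: has_field_derivative_iff)
  have inV: "\<forall>\<^sub>F \<zeta> in at \<zeta>0. \<zeta> \<in> V" using V \<zeta>0 by (simp add: eventually_at_in_open')
  \<comment> \<open>\<open>Q ?z = 0\<close> since the numerator vanishes there, so \<open>Q\<close>
    is continuous at \<open>?z\<close> itself, and parameters with
    \<open>\<gamma> \<zeta> = ?z\<close> cause no trouble in the composition.\<close>
  have "(Q \<longlongrightarrow> Q ?z) (at ?z within D)" using a by (simp add: Q_def)
  then have cQ: "continuous (at ?z within D) Q" by (simp add: continuous_within)
  have to_z: "(\<gamma> \<longlongrightarrow> ?z) (at \<zeta>0)"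
    using \<gamma>(1) V \<zeta>0 by (metis continuous_on_def at_within_open)
  have "\<forall>\<^sub>F \<zeta> in at \<zeta>0. \<gamma> \<zeta> \<in> D" using inV by eventually_elim (use \<gamma> in auto)
  then have "((\<lambda>\<zeta>. Q (\<gamma> \<zeta>)) \<longlongrightarrow> Q ?z) (at \<zeta>0)"
    by (rule continuous_within_tendsto_compose[OF cQ _ to_z])
  then have "((\<lambda>\<zeta>. Q (\<gamma> \<zeta>) * cnorm n (\<lambda>i. (\<gamma> \<zeta> i - ?z i) / (\<zeta> - \<zeta>0))) \<longlongrightarrow> Q ?z * cnorm n d) (at \<zeta>0)"
    by (intro tendsto_mult cnorm_tendsto d')
  then have 1: "((\<lambda>\<zeta>. Q (\<gamma> \<zeta>) * cnorm n (\<lambda>i. (\<gamma> \<zeta> i - ?z i) / (\<zeta> - \<zeta>0))) \<longlongrightarrow> 0) (at \<zeta>0)"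
    by (simp add: Q_def)
  have "\<forall>\<^sub>F \<zeta> in at \<zeta>0. Q (\<gamma> \<zeta>) * cnorm n (\<lambda>i. (\<gamma> \<zeta> i - ?z i) / (\<zeta> - \<zeta>0)) =
      cmod ((g (\<gamma> \<zeta>) - g ?z - (\<Sum>i<n. a i * (\<gamma> \<zeta> i - ?z i))) / (\<zeta> - \<zeta>0))"
    using inV
  proof eventually_elim
    case (elim \<zeta>)
    have sc: "cnorm n (\<lambda>i. v i / c) = cnorm n v / cmod c" for v c
      by (simp add: cnorm_def norm_mult norm_inverse divide_inverse L2_set_left_distrib)
    show ?case
      using cnorm_diff_eq_0_iff[of ?z n "\<gamma> \<zeta>"] elim z \<gamma> D
      by (cases "\<gamma> \<zeta> = ?z") (auto simp: Q_def sc norm_divide)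
  qed
  from Lim_transform_eventually[OF 1 this]
  have "((\<lambda>\<zeta>. (g (\<gamma> \<zeta>) - g ?z - (\<Sum>i<n. a i * (\<gamma> \<zeta> i - ?z i))) / (\<zeta> - \<zeta>0)) \<longlongrightarrow> 0) (at \<zeta>0)"
    by (rule tendsto_norm_zero_cancel)
  moreover have "((\<lambda>\<zeta>. \<Sum>i<n. a i * ((\<gamma> \<zeta> i - ?z i) / (\<zeta> - \<zeta>0))) \<longlongrightarrow> (\<Sum>i<n. a i * d i)) (at \<zeta>0)"
    by (intro tendsto_intros d') auto
  ultimately have "((\<lambda>\<zeta>. (g (\<gamma> \<zeta>) - g ?z - (\<Sum>i<n. a i * (\<gamma> \<zeta> i - ?z i))) / (\<zeta> - \<zeta>0) +
      (\<Sum>i<n. a i * ((\<gamma> \<zeta> i - ?z i) / (\<zeta> - \<zeta>0)))) \<longlongrightarrow> 0 + (\<Sum>i<n. a i * d i)) (at \<zeta>0)"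
    by (rule tendsto_add)
  moreover have "(g (\<gamma> \<zeta>) - g ?z - (\<Sum>i<n. a i * (\<gamma> \<zeta> i - ?z i))) / (\<zeta> - \<zeta>0) +
      (\<Sum>i<n. a i * ((\<gamma> \<zeta> i - ?z i) / (\<zeta> - \<zeta>0))) = (g (\<gamma> \<zeta>) - g ?z) / (\<zeta> - \<zeta>0)" for \<zeta>
    by (simp add: sum_divide_distrib[symmetric] add_divide_distrib[symmetric])
  ultimately have "((\<lambda>\<zeta>. (g (\<gamma> \<zeta>) - g ?z) / (\<zeta> - \<zeta>0)) \<longlongrightarrow> (\<Sum>i<n. a i * d i)) (at \<zeta>0)" by simp
  then show "\<exists>f'. ((\<lambda>\<zeta>. g (\<gamma> \<zeta>)) has_field_derivative f') (at \<zeta>0)"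
    by (auto simp: has_field_derivative_iff)
qed

subsection \<open>Squeezing radii of products\<close>

lemma block_start_add_le:
  fixes k :: "nat \<Rightarrow> nat"
  assumes "j < j'"
  shows "(\<Sum>t<j. k t) + k j \<le> (\<Sum>t<j'. k t)"
proof -
  have "(\<Sum>t<j. k t) + k j = (\<Sum>t<Suc j. k t)" by simp
  also have "\<dots> \<le> (\<Sum>t<j'. k t)" using assms by (intro sum_mono2) auto
  finally show ?thesis .
qed

text \<open>Blocks of positive length are disjoint intervals with distinct starting points. This
  lets the first coordinates of the factors be moved independently.\<close>

lemma block_start_add_eq_iff:
  fixes k :: "nat \<Rightarrow> nat"
  assumes "i < k j" "1 \<le> k j'"
  shows "(\<Sum>t<j. k t) + i = (\<Sum>t<j'. k t) \<longleftrightarrow> j = j' \<and> i = 0"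
  using assms block_start_add_le[of j j' k] block_start_add_le[of j' j k]
  by (cases j j' rule: linorder_cases) auto

text \<open>Each coordinate is at most the norm in modulus, so the ball is a closed part of a
  compact box of discs.\<close>

lemma compact_cnorm_ball: "compact {w \<in> Cn n. cnorm n w \<le> r}"
proof -
  have "closed {w. cnorm n w \<le> r}"
  proof (rule closed_Collect_le)
    show "continuous_on UNIV (cnorm n)"
      unfolding continuous_on_def by (intro ballI cnorm_tendsto coordinate_tendsto)
  qed simp
  moreover have "compact (box_upto n (\<lambda>i. cball 0 r))" by (rule compact_box_upto) simp
  ultimately have "compact (box_upto n (\<lambda>i. cball 0 r) \<inter> {w. cnorm n w \<le> r})"
    by (rule compact_Int_closed[rotated])
  moreover have "box_upto n (\<lambda>i. cball 0 r) \<inter> {w. cnorm n w \<le> r} = {w \<in> Cn n. cnorm n w \<le> r}"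
  proof -
    have "cmod (w i) \<le> r" if "cnorm n w \<le> r" "i < n" for w i
      using member_le_L2_set[of "{..<n}" i "\<lambda>i. cmod (w i)"] that by (simp add: cnorm_def)
    then show ?thesis by (auto simp: box_upto_def Cn_def)
  qed
  ultimately show ?thesis by simp
qed

lemma cnorm_power2: "(cnorm n z)\<^sup>2 = (\<Sum>i<n. (cmod (z i))\<^sup>2)"
  by (simp add: cnorm_def L2_set_def sum_nonneg)

text \<open>The embedding \<open>F\<close> is read through the biholomorphism and restricted to one
  complex line in each factor, so that the Bessel-type inequality bounds the number \<open>l\<close>
  of factors. Taking \<open>s < r\<close> puts the closed ball of radius \<open>s\<close> inside the
  image.\<close>

lemma product_factors_le:
  assumes D: "openin (top_of_set (Cn n)) D"
    and F: "holomorphic_map n n D F" "F ` D \<subseteq> Bn n 1" "inj_on F D"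
    and ball: "Bn n r \<subseteq> F ` D" and s: "0 < s" "s < r"
    and k: "\<And>j. j < l \<Longrightarrow> 1 \<le> k j"
    and E: "\<And>j. j < l \<Longrightarrow> openin (top_of_set (Cn (k j))) (E j)"
    and bih: "biholomorphic n D (\<Sum>j<l. k j) (cart_prod l k E)"
  shows "real l * s\<^sup>2 \<le> 1"
proof -
  define N where "N = (\<Sum>j<l. k j)"
  define P where "P = cart_prod l k E"
  have "biholomorphic n D N P" using bih by (simp add: N_def P_def)
  then obtain \<theta> \<psi> where *: "holomorphic_map n N D \<theta> \<and> holomorphic_map N n P \<psi> \<and> \<theta> ` D = P \<and> \<psi> ` P = D \<and>
      (\<forall>z\<in>D. \<psi> (\<theta> z) = z) \<and> (\<forall>w\<in>P. \<theta> (\<psi> w) = w)"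
    unfolding biholomorphic_def by (elim exE) (rule that)
  then have \<theta>: "holomorphic_map n N D \<theta>" "\<theta> ` D = P" and \<psi>: "holomorphic_map N n P \<psi>" "\<psi> ` P = D"
    by simp_all
  have \<psi>\<theta>: "\<psi> (\<theta> z) = z" if "z \<in> D" for z using * that by simp
  have \<theta>\<psi>: "\<theta> (\<psi> w) = w" if "w \<in> P" for w using * that by simp
  have DC: "D \<subseteq> Cn n" using D by (rule openin_imp_subset)
  have PC: "P \<subseteq> Cn N" by (auto simp: P_def N_def cart_prod_def)
  have cF: "continuous_on D F" using F(1) DC by (rule holomorphic_map_imp_continuous_on)
  have c\<theta>: "continuous_on D \<theta>" using \<theta>(1) DC by (rule holomorphic_map_imp_continuous_on)
  have c\<psi>: "continuous_on P \<psi>" using \<psi>(1) PC by (rule holomorphic_map_imp_continuous_on)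
  have FC: "F ` D \<subseteq> Cn n" using F(1) by (simp add: holomorphic_map_def)
  \<comment> \<open>The part of the product over the closed ball of radius \<open>s\<close>. It is
    the image of this compact ball under the continuous inverse of \<open>F\<close> followed by
    \<theta>.\<close>
  define M where "M = {p \<in> P. cnorm n (F (\<psi> p)) \<le> s}"
  have sub: "{w \<in> Cn n. cnorm n w \<le> s} \<subseteq> F ` D" using ball s by (auto simp: Bn_def)
  have inv_D: "inv_into D F w \<in> D" if "w \<in> Cn n" "cnorm n w \<le> s" for w
    by (rule inv_into_into) (use sub that in auto)
  have "compact M"
  proof -
    have "compact (\<theta> ` inv_into D F ` {w \<in> Cn n. cnorm n w \<le> s})"
    proof (intro compact_continuous_image compact_cnorm_ball)
      show "continuous_on {w \<in> Cn n. cnorm n w \<le> s} (inv_into D F)"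
        using continuous_inverse_Cn[OF D cF FC F(3)] sub by (rule continuous_on_subset)
      show "continuous_on (inv_into D F ` {w \<in> Cn n. cnorm n w \<le> s}) \<theta>"
        using c\<theta> by (rule continuous_on_subset) (auto intro: inv_D)
    qed
    moreover have "\<theta> ` inv_into D F ` {w \<in> Cn n. cnorm n w \<le> s} = M"
    proof (intro subset_antisym subsetI)
      fix p assume p: "p \<in> M"
      then have "\<psi> p \<in> D" using \<psi>(2) by (auto simp: M_def)
      then have "\<theta> (inv_into D F (F (\<psi> p))) = p" "F (\<psi> p) \<in> Cn n"
        using p \<theta>\<psi> F(3) FC by (auto simp: M_def)
      then show "p \<in> \<theta> ` inv_into D F ` {w \<in> Cn n. cnorm n w \<le> s}"
        using p by (force simp: M_def)
    next
      fix p assume "p \<in> \<theta> ` inv_into D F ` {w \<in> Cn n. cnorm n w \<le> s}"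
      then obtain w where w: "w \<in> Cn n" "cnorm n w \<le> s" "p = \<theta> (inv_into D F w)" by blast
      then have wF: "w \<in> F ` D" using sub by blast
      have "inv_into D F w \<in> D" using w(1,2) by (rule inv_D)
      then show "p \<in> M"
        using w \<theta>(2) \<psi>\<theta> f_inv_into_f[OF wF] by (auto simp: M_def)
    qed
    ultimately show ?thesis by simp
  qed
  \<comment> \<open>The origin lies in a ball contained in the image; its preimage provides the base
    point \<open>p0\<close> in the product.\<close>
  have "(\<lambda>i. 0) \<in> Bn n r" using s by (simp add: Bn_def Cn_def cnorm_def L2_set_def)
  then obtain z0 where z0: "z0 \<in> D" "F z0 = (\<lambda>i. 0)" using ball by (metis imageE subsetD)
  define p0 where "p0 = \<theta> z0"
  have p0: "p0 \<in> P" "F (\<psi> p0) = (\<lambda>i. 0)" using z0 \<theta>(2) \<psi>\<theta> by (auto simp: p0_def)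

  \<comment> \<open>Slices through the base point, one complex variable per factor\<close>
  define idx where "idx = (\<lambda>j. \<Sum>t<j. k t)"
  have idx_eq: "idx j + i = idx j' \<longleftrightarrow> j = j' \<and> i = 0" if "j < l" "j' < l" "i < k j" for i j j'
    unfolding idx_def using that k by (intro block_start_add_eq_iff) auto
  have idx_inj: "idx j = idx j' \<longleftrightarrow> j = j'" if "j < l" "j' < l" for j j'
    using idx_eq[of j j' 0] that k[of j] by simp
  have idx_less: "idx j < N" if "j < l" for j
    using block_start_add_le[OF that, of k] k[OF that] by (simp add: idx_def N_def)
  \<comment> \<open>Adds \<open>\<zeta> j\<close> to the first coordinate of block \<open>j\<close>
    of \<open>p0\<close>. The form as a sum gives continuity and holomorphy termwise.\<close>
  define emb where "emb = (\<lambda>\<zeta> i. p0 i + (\<Sum>j<l. if i = idx j then \<zeta> j else 0))"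
  have emb_at: "emb \<zeta> (idx j) = p0 (idx j) + \<zeta> j" if "j < l" for \<zeta> j
  proof -
    have "(\<Sum>j'<l. if idx j = idx j' then \<zeta> j' else 0) = (\<Sum>j'<l. if j = j' then \<zeta> j' else 0)"
      using that idx_inj by (intro sum.cong) auto
    then show ?thesis using that by (simp add: emb_def)
  qed
  have emb_off: "emb \<zeta> i = p0 i" if "\<And>j. j < l \<Longrightarrow> i = idx j \<Longrightarrow> \<zeta> j = 0" for \<zeta> i
    using that by (auto simp: emb_def intro!: sum.neutral)
  have emb_Cn: "emb \<zeta> \<in> Cn N" for \<zeta>
  proof -
    have "emb \<zeta> i = p0 i" if "N \<le> i" for i
      using that idx_less by (intro emb_off) force
    then show ?thesis using PC p0(1) by (auto simp: Cn_def)
  qed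
  \<comment> \<open>Block \<open>j\<close> of \<open>emb \<zeta>\<close> as a function of
    \<open>\<zeta> j\<close> alone, so that membership in the product splits into conditions on the
    single variables.\<close>
  define slot where "slot = (\<lambda>j x. (coord_block k j p0)(0 := p0 (idx j) + x))"
  have block_emb: "coord_block k j (emb \<zeta>) = slot j (\<zeta> j)" if j: "j < l" for j \<zeta>
  proof
    fix i
    show "coord_block k j (emb \<zeta>) i = slot j (\<zeta> j) i"
    proof (cases "i = 0")
      case True
      then show ?thesis
        using emb_at[OF j] k[OF j] by (simp add: coord_block_def slot_def idx_def)
    next
      case False
      then have "emb \<zeta> (idx j + i) = p0 (idx j + i)" if "i < k j"
        using idx_eq[OF j _ that] by (intro emb_off) auto
      then show ?thesis using False by (auto simp: coord_block_def slot_def idx_def)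
    qed
  qed
  define \<Omega> where "\<Omega> = (\<lambda>j. {x. slot j x \<in> E j})"
  have emb_P: "emb \<zeta> \<in> P \<longleftrightarrow> (\<forall>j<l. \<zeta> j \<in> \<Omega> j)" for \<zeta>
    using emb_Cn block_emb by (auto simp: P_def cart_prod_def N_def \<Omega>_def)
  have emb0: "emb (\<lambda>i. 0) = p0" by (rule ext) (simp add: emb_off)
  have \<Omega>0: "0 \<in> \<Omega> j" if "j < l" for j
    using emb_P[of "\<lambda>i. 0"] emb0 p0(1) that by simp
  have co: "continuous_on X (\<lambda>z :: nat \<Rightarrow> complex. z i)" for X i
    using continuous_on_product_coordinates by (rule continuous_on_subset) simp
  have c_emb: "continuous_on X emb" for X
  proof (rule continuous_on_coordinatewise_then_product)
    fix i
    have "continuous_on X (\<lambda>\<zeta>. if i = idx j then \<zeta> j else (0::complex))" for j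
      by (cases "i = idx j") (simp_all add: co)
    then show "continuous_on X (\<lambda>\<zeta>. emb \<zeta> i)"
      unfolding emb_def by (intro continuous_on_add continuous_on_sum continuous_on_const)
  qed
  have o\<Omega>: "open (\<Omega> j)" if j: "j < l" for j
  proof -
    have "continuous_on UNIV (slot j)"
      unfolding slot_def by (intro continuous_on_fun_upd continuous_intros)
    moreover have "slot j \<in> UNIV \<rightarrow> Cn (k j)"
      using k[OF j] by (auto simp: slot_def Cn_def coord_block_def)
    ultimately have "openin (top_of_set UNIV) (UNIV \<inter> slot j -` E j)"
      using E[OF j] by (rule continuous_openin_preimage)
    moreover have "UNIV \<inter> slot j -` E j = \<Omega> j" by (auto simp: \<Omega>_def)
    ultimately show ?thesis by simp
  qed

  \<comment> \<open>The separately holomorphic map and its sublevel sets on the axes\<close>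
  define \<phi> where "\<phi> = (\<lambda>\<zeta>. F (\<psi> (emb \<zeta>)))"
  have \<psi>D: "\<psi> p \<in> D" if "p \<in> P" for p using \<psi>(2) that by blast
  have c\<phi>: "continuous_on X (\<lambda>\<zeta>. \<phi> \<zeta> i)" if "\<And>\<zeta>. \<zeta> \<in> X \<Longrightarrow> emb \<zeta> \<in> P" for X i
  proof -
    have "continuous_on X \<phi>"
      unfolding \<phi>_def
      by (intro continuous_on_compose2[OF cF] continuous_on_compose2[OF c\<psi>] c_emb) (use that \<psi>D in auto)
    then show ?thesis by (rule continuous_on_product_then_coordinatewise)
  qed
  have axis: "emb ((\<lambda>i. 0)(j := x)) \<in> P \<longleftrightarrow> x \<in> \<Omega> j" if "j < l" for j x
    using that \<Omega>0 by (auto simp: emb_P)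
  define u where "u = (\<lambda>j x. cnorm n (\<phi> ((\<lambda>i. 0)(j := x))))"
  define K where "K = (\<lambda>j. {x \<in> \<Omega> j. u j x \<le> s})"
  have cu: "continuous_on (\<Omega> j) (u j)" if j: "j < l" for j
  proof -
    have "continuous_on (\<Omega> j) (\<lambda>x. \<phi> ((\<lambda>i. 0)(j := x)) i)" for i
    proof -
      have 1: "continuous_on ((\<lambda>x. (\<lambda>i. 0)(j := x)) ` \<Omega> j) (\<lambda>\<zeta>. \<phi> \<zeta> i)"
        using axis[OF j] by (intro c\<phi>) auto
      have 2: "continuous_on (\<Omega> j) (\<lambda>x :: complex. (\<lambda>i :: nat. 0)(j := x))"
        by (intro continuous_on_fun_upd continuous_on_const continuous_on_id)
      show ?thesis using continuous_on_compose2[OF 1 2] by simp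
    qed
    then show ?thesis
      unfolding u_def continuous_on_def by (intro ballI cnorm_tendsto) blast
  qed
  have cK: "compact (K j)" if j: "j < l" for j
  proof -
    \<comment> \<open>Points that agree with \<open>p0\<close> in all coordinates but
      \<open>idx j\<close>. They form a closed set, so its trace on \<open>M\<close> is compact, and
      the translated free coordinate maps this trace onto \<open>K j\<close>.\<close>
    let ?A = "\<Inter>i\<in>- {idx j}. {p. p i = p0 i}"
    have "closed {p. p i = p0 i}" for i
      by (intro closed_Collect_eq co continuous_on_const)
    then have "compact (M \<inter> ?A)" using \<open>compact M\<close> by (intro compact_Int_closed) auto
    then have "compact ((\<lambda>p. p (idx j) - p0 (idx j)) ` (M \<inter> ?A))"
      by (intro compact_continuous_image continuous_on_diff co continuous_on_const)
    moreover have "(\<lambda>p. p (idx j) - p0 (idx j)) ` (M \<inter> ?A) = K j"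
    proof (intro subset_antisym subsetI)
      fix x assume x: "x \<in> K j"
      let ?p = "emb ((\<lambda>i. 0)(j := x))"
      have 1: "?p \<in> M" using x axis[OF j] by (simp add: K_def M_def u_def \<phi>_def)
      have 2: "?p \<in> ?A" by (auto intro!: emb_off split: if_splits)
      have 3: "x = ?p (idx j) - p0 (idx j)" by (simp add: emb_at[OF j])
      show "x \<in> (\<lambda>p. p (idx j) - p0 (idx j)) ` (M \<inter> ?A)"
        using 3 IntI[OF 1 2] by (rule image_eqI[where x = ?p])
    next
      fix x assume "x \<in> (\<lambda>p. p (idx j) - p0 (idx j)) ` (M \<inter> ?A)"
      then obtain p where p: "p \<in> M" "p \<in> ?A" "x = p (idx j) - p0 (idx j)" by blast
      have "emb ((\<lambda>i. 0)(j := x)) i = p i" for i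
      proof (cases "i = idx j")
        case True
        then show ?thesis using p(3) by (simp add: emb_at[OF j])
      next
        case False
        then have "emb ((\<lambda>i. 0)(j := x)) i = p0 i" by (intro emb_off) auto
        with False p(2) show ?thesis by auto
      qed
      then have "emb ((\<lambda>i. 0)(j := x)) = p" by blast
      then show "x \<in> K j" using p(1) axis[OF j, of x] by (simp add: K_def M_def u_def \<phi>_def)
    qed
    ultimately show ?thesis by simp
  qed
  have boxP: "emb z \<in> P" if "z \<in> box_upto l K" for z
    using that by (auto simp: emb_P box_upto_def K_def)
  have u0: "u j 0 = 0" for j
    by (simp add: u_def \<phi>_def fun_upd_idem emb0 p0(2) cnorm_def L2_set_def)
  \<comment> \<open>The level sets where \<open>u j = s\<close> carry the averages; the sublevel
    sets \<open>K j\<close> contain both them and 0.\<close>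
  show ?thesis
  proof (rule separately_holomorphic_bessel[where K = K and S = "\<lambda>j. {x \<in> \<Omega> j. u j x = s}" and U = \<Omega> and \<phi> = \<phi> and n = n])
    show "compact (K j)" if "j < l" for j using cK[OF that] .
    show "{x \<in> \<Omega> j. u j x = s} \<subseteq> K j" for j by (auto simp: K_def)
    show "0 \<in> K j" if "j < l" for j using \<Omega>0[OF that] s by (simp add: K_def u0)
    show "continuous_on (box_upto l K) (\<lambda>z. \<phi> z i)" for i using boxP by (rule c\<phi>)
    show "(\<lambda>x. \<phi> (z(j := x)) i) holomorphic_on \<Omega> j" if z: "z \<in> box_upto l K" and j: "j < l" and i: "i < n" for z j i
    proof -
      have inP: "emb (z(j := x)) \<in> P" if "x \<in> \<Omega> j" for x
        using that z by (auto simp: emb_P box_upto_def K_def)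
      have cline: "continuous_on (\<Omega> j) (\<lambda>x. emb (z(j := x)))"
        by (rule continuous_on_compose2[OF c_emb[of UNIV]]) (auto intro!: continuous_on_fun_upd continuous_on_const continuous_on_id)
      have hline: "(\<lambda>x. emb (z(j := x)) i') holomorphic_on \<Omega> j" for i'
      proof -
        have "(\<lambda>x. if i' = idx t then (z(j := x)) t else 0) holomorphic_on \<Omega> j" for t
          by (cases "i' = idx t"; cases "t = j") (auto intro: holomorphic_intros)
        then show ?thesis unfolding emb_def by (intro holomorphic_intros)
      qed
      \<comment> \<open>The chain rule is applied twice: to \<psi> along the affine line, then to
        \<open>F\<close> along the resulting curve.\<close>
      have "(\<lambda>x. \<psi> (emb (z(j := x))) i') holomorphic_on \<Omega> j" if "i' < n" for i'
        by (rule holomorphic_on_compose_curve[where g = "\<lambda>p. \<psi> p i'", OF PC _ o\<Omega>[OF j] cline])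
          (use \<psi>(1) that inP hline in \<open>auto simp: holomorphic_map_def\<close>)
      moreover have "continuous_on (\<Omega> j) (\<lambda>x. \<psi> (emb (z(j := x))))"
        by (rule continuous_on_compose2[OF c\<psi> cline]) (use inP in auto)
      ultimately have "(\<lambda>x. F (\<psi> (emb (z(j := x)))) i) holomorphic_on \<Omega> j"
        by (intro holomorphic_on_compose_curve[where g = "\<lambda>p. F p i", OF DC _ o\<Omega>[OF j]])
          (use F(1) i inP \<psi>D in \<open>auto simp: holomorphic_map_def\<close>)
      then show ?thesis by (simp add: \<phi>_def)
    qed
    \<comment> \<open>The maximum principle is used at \<open>\<xi> = 0\<close>, where
      \<open>u j 0 = 0 < s\<close>.\<close>
    show "\<exists>x\<in>{x \<in> \<Omega> j. u j x = s}. Re (h x) \<le> Re (h 0)" if "j < l" "h holomorphic_on \<Omega> j" for j h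
      using o\<Omega>[OF that(1)] cu[OF that(1)] cK[OF that(1)] \<Omega>0[OF that(1)] that(2) s
      by (intro exists_Re_le_on_level_set) (auto simp: K_def u0)
    show "(\<Sum>i<n. (cmod (\<phi> z i))\<^sup>2) \<le> 1" if "z \<in> box_upto l K" for z
    proof -
      have "\<phi> z \<in> Bn n 1" using F(2) \<psi>D[OF boxP[OF that]] by (auto simp: \<phi>_def)
      then have "0 \<le> cnorm n (\<phi> z)" "cnorm n (\<phi> z) \<le> 1" by (auto simp: Bn_def cnorm_def)
      then show ?thesis using power_le_one by (metis cnorm_power2)
    qed
    show "\<phi> (\<lambda>i. 0) i = 0" for i by (simp add: \<phi>_def emb0 p0(2))
    show "s\<^sup>2 \<le> (\<Sum>i<n. (cmod (\<phi> ((\<lambda>i. 0)(j := x)) i))\<^sup>2)" if "x \<in> {x \<in> \<Omega> j. u j x = s}" for j x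
      using that by (simp add: cnorm_power2[symmetric] u_def)
  qed
qed

text \<open>The strict inequality passes through both suprema to a single map \<open>F\<close> and a
  radius \<open>r\<close>. Then \<open>s > 1 / sqrt m\<close> means
  \<open>m * s\<^sup>2 > 1\<close>, whereas \<open>l\<close> factors force
  \<open>l * s\<^sup>2 \<le> 1\<close>.\<close>

lemma squeezing_function_gt_imp_less:
  assumes D: "cdomain n D" and m: "0 < m"
    and sq: "squeezing_function n D z > ereal (1 / sqrt (real m))"
    and k: "\<And>j. j < l \<Longrightarrow> 1 \<le> k j" and E: "\<And>j. j < l \<Longrightarrow> cdomain (k j) (E j)"
    and bih: "biholomorphic n D (\<Sum>j<l. k j) (cart_prod l k E)"
  shows "l < m"
proof -
  obtain F where F: "holomorphic_map n n D F" "F ` D \<subseteq> Bn n 1" "inj_on F D"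
    "squeezing_radius n D F > ereal (1 / sqrt (real m))"
    using sq unfolding squeezing_function_def less_Sup_iff by blast
  then obtain r where r: "Bn n r \<subseteq> F ` D" "r > 1 / sqrt (real m)"
    unfolding squeezing_radius_def less_Sup_iff by auto
  \<comment> \<open>A value strictly between is taken: \<open>product_factors_le\<close> asks for
    \<open>s < r\<close>, and the comparison with \<open>m\<close> for \<open>s\<close> above the
    threshold.\<close>
  obtain s where s: "1 / sqrt (real m) < s" "s < r" using r(2) dense by blast
  have pos: "0 < 1 / sqrt (real m)" using m by simp
  have "0 < s" using pos s(1) by (rule less_trans)
  then have "real l * s\<^sup>2 \<le> 1"
    using D E s(2) by (intro product_factors_le[OF _ F(1-3) r(1) _ _ k _ bih]) (auto simp: cdomain_def)
  moreover have "1 < real m * s\<^sup>2"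
  proof -
    have "(1 / sqrt (real m))\<^sup>2 < s\<^sup>2" using pos s(1) by (intro power_strict_mono) auto
    then show ?thesis using m by (simp add: power_divide field_simps)
  qed
  ultimately have "real l * s\<^sup>2 < real m * s\<^sup>2" by simp
  then show ?thesis by (simp add: mult_less_cancel_right)
qed

theorem theorem1p1:
  fixes n :: nat and D :: "(nat \<Rightarrow> complex) set"
  assumes "n \<ge> 2"
    and "cdomain n D"
    and "cbounded n D"
    and "pseudoconvex n D"
  shows
    "(contractible D \<longrightarrow>
       (\<forall>m::nat. 2 \<le> m \<and> m \<le> n \<and>
          (\<exists>z\<in>D. squeezing_function n D z > ereal (1 / sqrt (real m))) \<longrightarrow>
          \<not> (\<exists>l k E. l \<ge> m \<and> (\<forall>j<l. irreducible_domain (k j) (E j)) \<and>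
                biholomorphic n D (\<Sum>j<l. k j) (cart_prod l k E)))) \<and>
     (n \<ge> 4 \<longrightarrow>
       (\<forall>m::nat. 2 \<le> m \<and> real m \<le> real n / 2 \<and>
          (\<exists>z\<in>D. squeezing_function n D z > ereal (1 / sqrt (real m))) \<longrightarrow>
          \<not> (\<exists>k E. (\<forall>j<m. k j \<ge> 2 \<and> cdomain (k j) (E j)) \<and>
                biholomorphic n D (\<Sum>j<m. k j) (cart_prod m k E))))"
proof -
  \<comment> \<open>Common core of both parts. It contradicts \<open>m \<le> l\<close> in (a) and is
    applied with \<open>l = m\<close> in (b).\<close>
  have *: "l < m" if "2 \<le> m" "z \<in> D" "squeezing_function n D z > ereal (1 / sqrt (real m))"
    "\<And>j. j < l \<Longrightarrow> 1 \<le> k j \<and> cdomain (k j) (E j)"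
    "biholomorphic n D (\<Sum>j<l. k j) (cart_prod l k E)" for l m z k E
    by (rule squeezing_function_gt_imp_less[OF \<open>cdomain n D\<close> _ that(3) _ _ that(5)]) (use that in auto)
  have irr: "1 \<le> d \<and> cdomain d X" if "irreducible_domain d X" for d X
    using that by (auto simp: irreducible_domain_def)
  show ?thesis
  proof (intro conjI impI allI notI; elim exE conjE bexE)
    fix m z l k E
    assume "2 \<le> m" "z \<in> D" "squeezing_function n D z > ereal (1 / sqrt (real m))" "m \<le> l"
      "\<forall>j<l. irreducible_domain (k j) (E j)" "biholomorphic n D (\<Sum>j<l. k j) (cart_prod l k E)"
    then show False using *[of m z l k E] irr by auto
  next
    fix m z k E
    assume "2 \<le> m" "z \<in> D" "squeezing_function n D z > ereal (1 / sqrt (real m))"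
      "\<forall>j<m. 2 \<le> k j \<and> cdomain (k j) (E j)" "biholomorphic n D (\<Sum>j<m. k j) (cart_prod m k E)"
    then show False using *[of m z m k E] by force
  qed
qed

end
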